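(* Let $\widetilde{\mathrm{A}}_4\cong \mathrm{SL}_2(\mathbb{F}_3)$ be the binary tetrahedral group (of order $24$), and let $K$ be a field whose characteristic does not divide $24$ and which contains an element of multiplicative order $8$. Then $\beta_{\mathrm{sep}}^K(\widetilde{\mathrm{A}}_4)=12$.
   Context: Let $K$ be a field and $G$ a finite group with $\mathrm{char}(K)\nmid |G|$. For a finite dimensional $KG$-module $V$, $K[V]$ is the polynomial ring in the coordinate functions on $V$, on which $G$ acts by $(g\cdot f)(v)=f(g^{-1}v)$, and $K[V]^G$ is the subalgebra of $G$-invariants. A subset $S\subseteq K[V]^G$ is a separating set if whenever $v,w\in V$ have different $G$-orbits, there is $f\in S$ with $f(v)\ne f(w)$. The number $\beta_{\mathrm{sep}}(G,V)$ is the minimal positive integer $d$ such that the elements of $K[V]^G$ of degree at most $d$ form a separating set, and $\beta_{\mathrm{sep}}^K(G)$ is the supremum of $\beta_{\mathrm{sep}}(G,V)$ over all finite dimensional $KG$-modules $V$. The binary tetrahedral group is the preimage of $\mathrm{A}_4\subset \mathrm{SO}(3,\mathbb{R})$ (rotations of a regular tetrahedron) under the two-fold covering $\mathrm{SU}(2,\mathbb{C})\to \mathrm{SO}(3,\mathbb{R})$; equivalently, it is the non-abelian semidirect product $\mathrm{Dic}_8\rtimes \mathrm{C}_3$ (non-direct) of the quaternion group of order $8$ with the cyclic group of order $3$. *)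

theory Defs
  imports
    Jordan_Normal_Form.Determinant
    Jordan_Normal_Form.Schur_Decomposition
    "HOL-Library.Poly_Mapping"
    "HOL-Library.Numeral_Type"
    "HOL-Library.Extended_Nat"
    "HOL-Algebra.Coset"
begin

section \<open>Matrix groups\<close>

definition GL :: "nat \<Rightarrow> 'a::comm_ring_1 mat monoid" where
  "GL n = units_of (ring_mat TYPE('a) n ())"

definition SL :: "nat \<Rightarrow> 'a::comm_ring_1 mat monoid" where
  "SL n = (GL n)\<lparr>carrier := {A \<in> carrier_mat n n. det A = 1}\<rparr>"

definition SU :: "nat \<Rightarrow> complex mat monoid" where
  "SU n = (GL n)\<lparr>carrier :=
     {U \<in> carrier_mat n n. U * mat_adjoint U = 1\<^sub>m n \<and> det U = 1}\<rparr>"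

definition SO :: "nat \<Rightarrow> real mat monoid" where
  "SO n = (GL n)\<lparr>carrier :=
     {R \<in> carrier_mat n n. R * transpose_mat R = 1\<^sub>m n \<and> det R = 1}\<rparr>"


section \<open>The binary tetrahedral group\<close>

definition pauli :: "nat \<Rightarrow> complex mat" where
  "pauli i = mat_of_rows_list 2
     ([[[0, 1], [1, 0]],
       [[0, - \<i>], [\<i>, 0]],
       [[1, 0], [0, - 1]]] ! i)"

text \<open>
  Identify \<open>x \<in> \<real>\<^sup>3\<close> with the traceless Hermitian matrix \<open>\<Sum>j<3. x\<^sub>j \<cdot> pauli j\<close>. The two-fold
  covering \<open>SU 2 \<rightarrow> SO 3\<close> sends \<open>U\<close> to the rotation \<open>H \<mapsto> U * H * mat_adjoint U\<close>. Since
  \<open>trace (pauli i * pauli j) = (if i = j then 2 else 0)\<close>, the matrix of this rotation has entries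
  \<open>trace (pauli i * (U * pauli j * mat_adjoint U)) / 2\<close>, which are real.
\<close>
definition spin_cover :: "complex mat \<Rightarrow> real mat" where
  "spin_cover U = mat 3 3 (\<lambda>(i, j).
     let A = pauli i * (U * pauli j * mat_adjoint U) in Re (\<Sum>k<2. A $$ (k, k)) / 2)"

definition tetrahedron_vertices :: "real vec set" where
  "tetrahedron_vertices = vec_of_list ` {[1, 1, 1], [1, - 1, - 1], [- 1, 1, - 1], [- 1, - 1, 1]}"

definition tetrahedral_rotations :: "real mat set" where
  "tetrahedral_rotations =
     {R \<in> carrier (SO 3). (\<lambda>x. R *\<^sub>v x) ` tetrahedron_vertices = tetrahedron_vertices}"

definition binary_tetrahedral :: "complex mat monoid" where
  "binary_tetrahedral =
     (SU 2)\<lparr>carrier := {U \<in> carrier (SU 2). spin_cover U \<in> tetrahedral_rotations}\<rparr>"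


section \<open>Polynomials\<close>

text \<open>
  Formal polynomials in the variables \<open>x\<^sub>0, x\<^sub>1, \<dots>\<close>: a monomial is a finitely supported exponent
  function and a polynomial a finitely supported coefficient function. They must not be replaced
  by polynomial functions, since the field may be finite.
\<close>
type_synonym 'a mpoly = "(nat \<Rightarrow>\<^sub>0 nat) \<Rightarrow>\<^sub>0 'a"

definition mpoly_const :: "'a::comm_ring_1 \<Rightarrow> 'a mpoly" where
  "mpoly_const c = Poly_Mapping.single 0 c"

definition mpoly_var :: "nat \<Rightarrow> 'a::comm_ring_1 mpoly" where
  "mpoly_var i = Poly_Mapping.single (Poly_Mapping.single i 1) 1"

text \<open>Apply \<open>c\<close> to the coefficients and substitute \<open>f i\<close> for the variable \<open>x\<^sub>i\<close>.\<close>
definition mpoly_subst ::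
    "('a::comm_ring_1 \<Rightarrow> 'b::comm_ring_1) \<Rightarrow> (nat \<Rightarrow> 'b) \<Rightarrow> 'a mpoly \<Rightarrow> 'b" where
  "mpoly_subst c f p =
     (\<Sum>m\<in>Poly_Mapping.keys p. c (Poly_Mapping.lookup p m) *
        (\<Prod>i\<in>Poly_Mapping.keys m. f i ^ Poly_Mapping.lookup m i))"

definition mpoly_eval :: "'a::comm_ring_1 mpoly \<Rightarrow> 'a vec \<Rightarrow> 'a" where
  "mpoly_eval p v = mpoly_subst (\<lambda>a. a) (\<lambda>i. v $ i) p"

definition total_degree :: "'a::comm_ring_1 mpoly \<Rightarrow> nat" where
  "total_degree p = Max (insert 0
     ((\<lambda>m. \<Sum>i\<in>Poly_Mapping.keys m. Poly_Mapping.lookup m i) ` Poly_Mapping.keys p))"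

definition mpoly_ring :: "nat \<Rightarrow> 'a::comm_ring_1 mpoly set" where
  "mpoly_ring n = {p. \<forall>m\<in>Poly_Mapping.keys p. Poly_Mapping.keys m \<subseteq> {..<n}}"


section \<open>Invariants and separating sets\<close>

text \<open>
  A finite dimensional module \<open>V\<close> over the group algebra of \<open>G\<close> is given in coordinates: \<open>V\<close> is
  \<open>carrier_vec n\<close>, and \<open>G\<close> acts through a homomorphism \<open>\<rho> \<in> hom G (GL n)\<close>.

  The \<open>i\<close>-th coordinate of \<open>\<rho> (inv g) *\<^sub>v v\<close> is \<open>\<Sum>j<n. \<rho> (inv g) $$ (i, j) * v $ j\<close>, so
  \<open>(g \<cdot> f) v = f (inv g \<cdot> v)\<close> means substituting the following linear forms for the variables.
\<close>
definition mpoly_act ::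
    "('g, 'm) monoid_scheme \<Rightarrow> nat \<Rightarrow> ('g \<Rightarrow> 'k::field mat) \<Rightarrow> 'g \<Rightarrow> 'k mpoly \<Rightarrow> 'k mpoly" where
  "mpoly_act G n \<rho> g p = mpoly_subst mpoly_const
     (\<lambda>i. \<Sum>j<n. mpoly_const (\<rho> (inv\<^bsub>G\<^esub> g) $$ (i, j)) * mpoly_var j) p"

definition invariants ::
    "('g, 'm) monoid_scheme \<Rightarrow> nat \<Rightarrow> ('g \<Rightarrow> 'k::field mat) \<Rightarrow> 'k mpoly set" where
  "invariants G n \<rho> = {p \<in> mpoly_ring n. \<forall>g\<in>carrier G. mpoly_act G n \<rho> g p = p}"

definition vec_orbit ::
    "('g, 'm) monoid_scheme \<Rightarrow> ('g \<Rightarrow> 'k::field mat) \<Rightarrow> 'k vec \<Rightarrow> 'k vec set" where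
  "vec_orbit G \<rho> v = (\<lambda>g. \<rho> g *\<^sub>v v) ` carrier G"

definition separating_set ::
    "('g, 'm) monoid_scheme \<Rightarrow> nat \<Rightarrow> ('g \<Rightarrow> 'k::field mat) \<Rightarrow> 'k mpoly set \<Rightarrow> bool" where
  "separating_set G n \<rho> S \<longleftrightarrow> S \<subseteq> invariants G n \<rho> \<and>
     (\<forall>v\<in>carrier_vec n. \<forall>w\<in>carrier_vec n. vec_orbit G \<rho> v \<noteq> vec_orbit G \<rho> w \<longrightarrow>
        (\<exists>f\<in>S. mpoly_eval f v \<noteq> mpoly_eval f w))"

text \<open>
  As an infimum in \<^typ>\<open>enat\<close>, this is the least such \<open>d\<close>, and it is \<open>\<infinity>\<close> if there is none.
\<close>
definition beta_sep ::
    "('g, 'm) monoid_scheme \<Rightarrow> nat \<Rightarrow> ('g \<Rightarrow> 'k::field mat) \<Rightarrow> enat" where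
  "beta_sep G n \<rho> = Inf {enat d | d. 0 < d \<and>
     separating_set G n \<rho> {f \<in> invariants G n \<rho>. total_degree f \<le> d}}"

definition beta_sep_group :: "'k::field itself \<Rightarrow> ('g, 'm) monoid_scheme \<Rightarrow> enat" where
  "beta_sep_group _ G =
     Sup {beta_sep G n \<rho> | n (\<rho> :: 'g \<Rightarrow> 'k mat). \<rho> \<in> hom G (GL n)}"

end

(*
  Upper bound. By averaging, two points that invariants of degree at most 12 do not separate agree
  under every polynomial function of degree at most 12 that is invariant as a function. Let q range
  over the functions of degree at most 2 invariant under the center and split q into the components
  q_0, q_x, q_y, q_z on which Q8 acts by its four sign characters, which the element s of order 3
  permutes as x, y, z. The Q8-invariant functions of degree at most 4 separate orbits up to a power
  of s, by taking the product of three translates. Then q_0 and all q_x q_x', q_y q_y', q_z q_z'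
  agree at both points v and w, so q_x(w) = e_x q_x(v) with a sign e_x independent of q, and so on.
  An invariant of degree 6, the product of the s-translates of q_x, forces e_x e_y e_z = 1 for a
  suitable choice of signs, and such signs come from an element of Q8. As the functions q separate
  points up to the center, v and w lie in one orbit.

  Lower bound. On the two-dimensional representation, the invariants restricted to the line (t, 0)
  involve only powers of t^4. The coefficient of t^4 vanishes because the six lines through
  (1, 0), (0, 1) and (1, e) with e^4 = 1 form one orbit. Hence no invariant of degree below 12
  separates (1, 0) from (zeta, 0), where zeta has order 8.
*)
theory Submission
  imports Defs
begin

section \<open>Substitution and degree\<close>

text \<open>The bound splits as 12 = 3 * 4: a function of degree 4 invariant under Q8 becomes
  invariant under the whole group after multiplication by its translates under s and s^2. Hence
  invariants stay formal while the upper bound compares functions; the three functions that keep w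
  away from the three translates of v are packed into one polynomial in an auxiliary indeterminate;
  and hyperplane coverings are excluded by the four scalars 0, 1, -1, 2, distinct because the
  characteristic is neither 2 nor 3. The relation between the signs is forced only if all three
  components occur at v; otherwise one sign is free and is chosen to fit. The subgroup of SU(2), the
  group SL_2(F_3) and the representation for the lower bound are images of one list of 24 Hurwitz
  units under one family of matrices. The element zeta enters twice: zeta^2 is the square root of -1
  in the representation, and zeta^8 = 1 hides (zeta, 0) from the degrees 0 and 8, the only ones
  below 12 that survive on the line.\<close>

definition monom_value :: "(nat \<Rightarrow> 'b::comm_ring_1) \<Rightarrow> (nat \<Rightarrow>\<^sub>0 nat) \<Rightarrow> 'b" where
  "monom_value s m = (\<Prod>i\<in>Poly_Mapping.keys m. s i ^ Poly_Mapping.lookup m i)"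

lemma monom_value_superset:
  assumes "finite A" "Poly_Mapping.keys m \<subseteq> A"
  shows "monom_value s m = (\<Prod>i\<in>A. s i ^ Poly_Mapping.lookup m i)"
  unfolding monom_value_def using assms
  by (intro prod.mono_neutral_left) (auto simp: in_keys_iff)

lemma monom_value_add: "monom_value s (m + m') = monom_value s m * monom_value s m'"
proof -
  let ?A = "Poly_Mapping.keys m \<union> Poly_Mapping.keys m'"
  have "monom_value s (m + m') = (\<Prod>i\<in>?A. s i ^ Poly_Mapping.lookup (m + m') i)"
    by (rule monom_value_superset) (auto simp: in_keys_iff lookup_add)
  also have "\<dots> = monom_value s m * monom_value s m'"
    by (simp add: lookup_add power_add prod.distrib
        monom_value_superset[of ?A m] monom_value_superset[of ?A m'])
  finally show ?thesis .
qed

lemma monom_value_0 [simp]: "monom_value s 0 = 1"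
  by (simp add: monom_value_def)

lemma monom_value_single: "monom_value s (Poly_Mapping.single i k) = s i ^ k"
  by (simp add: monom_value_def)

lemma mpoly_subst_superset:
  assumes "finite A" "Poly_Mapping.keys p \<subseteq> A" "c 0 = 0"
  shows "mpoly_subst c s p = (\<Sum>m\<in>A. c (Poly_Mapping.lookup p m) * monom_value s m)"
  unfolding mpoly_subst_def monom_value_def[symmetric] using assms
  by (intro sum.mono_neutral_left) (auto simp: in_keys_iff)

lemma mpoly_subst_cong:
  assumes "p \<in> mpoly_ring n" "\<And>i. i < n \<Longrightarrow> s i = s' i"
  shows "mpoly_subst c s p = mpoly_subst c s' p"
  unfolding mpoly_subst_def using assms
  by (intro sum.cong prod.cong arg_cong2[of _ _ _ _ "(*)"] refl) (auto simp: mpoly_ring_def subset_iff)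

lemma mpoly_sum_single:
  fixes p :: "'a::comm_ring_1 mpoly"
  shows "p = (\<Sum>m\<in>Poly_Mapping.keys p. Poly_Mapping.single m (Poly_Mapping.lookup p m))"
  by (rule poly_mapping_eqI)
    (auto simp: lookup_sum lookup_single when_def in_keys_iff sum.delta)

text \<open>The coefficient map stays arbitrary because three instances occur: the identity for
  evaluation, \<open>mpoly_const\<close> for the group action, and constant univariate polynomials
  for the restriction to a line.\<close>

context comm_ring_hom
begin

lemma mpoly_subst_single: "mpoly_subst hom s (Poly_Mapping.single m c) = hom c * monom_value s m"
  by (simp add: mpoly_subst_def monom_value_def)

lemma mpoly_subst_const: "mpoly_subst hom s (mpoly_const c) = hom c"
  by (simp add: mpoly_const_def mpoly_subst_single)

lemma mpoly_subst_var: "mpoly_subst hom s (mpoly_var i) = s i"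
  by (simp add: mpoly_var_def mpoly_subst_single monom_value_single)

lemma mpoly_subst_add: "mpoly_subst hom s (p + q) = mpoly_subst hom s p + mpoly_subst hom s q"
proof -
  let ?A = "Poly_Mapping.keys p \<union> Poly_Mapping.keys q"
  show ?thesis
    using keys_add[of p q]
    by (subst (1 2 3) mpoly_subst_superset[of ?A])
      (auto simp: lookup_add hom_add distrib_right sum.distrib)
qed

lemma mpoly_subst_0: "mpoly_subst hom s 0 = 0"
  by (simp add: mpoly_subst_def)

lemma mpoly_subst_sum: "mpoly_subst hom s (\<Sum>x\<in>A. f x) = (\<Sum>x\<in>A. mpoly_subst hom s (f x))"
  by (induction A rule: infinite_finite_induct) (auto simp: mpoly_subst_0 mpoly_subst_add)

lemma mpoly_subst_mult: "mpoly_subst hom s (p * q) = mpoly_subst hom s p * mpoly_subst hom s q"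
proof -
  have "mpoly_subst hom s (p * q) = mpoly_subst hom s
      (\<Sum>m\<in>Poly_Mapping.keys p. \<Sum>m'\<in>Poly_Mapping.keys q.
        Poly_Mapping.single (m + m') (Poly_Mapping.lookup p m * Poly_Mapping.lookup q m'))"
    by (subst mpoly_sum_single[of p], subst mpoly_sum_single[of q])
      (simp add: sum_product mult_single)
  also have "\<dots> = (\<Sum>m\<in>Poly_Mapping.keys p. \<Sum>m'\<in>Poly_Mapping.keys q.
      (hom (Poly_Mapping.lookup p m) * monom_value s m) *
      (hom (Poly_Mapping.lookup q m') * monom_value s m'))"
    by (simp add: mpoly_subst_sum mpoly_subst_single monom_value_add hom_mult mult_ac)
  also have "\<dots> = mpoly_subst hom s p * mpoly_subst hom s q"
    by (simp add: sum_product mpoly_subst_def monom_value_def)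
  finally show ?thesis .
qed

lemma mpoly_subst_power: "mpoly_subst hom s (p ^ k) = mpoly_subst hom s p ^ k"
  by (induction k) (simp_all add: mpoly_subst_mult mpoly_subst_const[of _ 1, unfolded mpoly_const_def, simplified])

lemma mpoly_subst_prod: "mpoly_subst hom s (\<Prod>x\<in>A. f x) = (\<Prod>x\<in>A. mpoly_subst hom s (f x))"
  by (induction A rule: infinite_finite_induct)
    (auto simp: mpoly_subst_mult mpoly_subst_const[of _ 1, unfolded mpoly_const_def, simplified])

lemma mpoly_subst_subst:
  "mpoly_subst hom s (mpoly_subst mpoly_const t p) = mpoly_subst hom (\<lambda>i. mpoly_subst hom s (t i)) p"
  unfolding mpoly_subst_def[of mpoly_const t] mpoly_subst_def[of hom "\<lambda>i. mpoly_subst hom s (t i)"]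
  by (simp add: mpoly_subst_sum mpoly_subst_mult mpoly_subst_const mpoly_subst_prod mpoly_subst_power)

end

lemma comm_ring_hom_id: "comm_ring_hom (\<lambda>a :: 'a::comm_ring_1. a)"
  by unfold_locales auto

lemma comm_ring_hom_mpoly_const: "comm_ring_hom (mpoly_const :: 'a::comm_ring_1 \<Rightarrow> _)"
  by unfold_locales (auto simp: mpoly_const_def single_add mult_single)

lemma (in comm_ring_hom) hom_mpoly_subst:
  "hom (mpoly_subst c s p) = mpoly_subst (\<lambda>a. hom (c a)) (\<lambda>i. hom (s i)) p"
  by (simp add: mpoly_subst_def hom_sum hom_mult hom_prod hom_power)

lemma mpoly_ring_add: "p \<in> mpoly_ring n \<Longrightarrow> q \<in> mpoly_ring n \<Longrightarrow> p + q \<in> mpoly_ring n"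
  using keys_add[of p q] by (auto simp: mpoly_ring_def subset_iff)

lemma mpoly_ring_mult: 
  assumes "p \<in> mpoly_ring n" "q \<in> mpoly_ring n" shows "p * q \<in> mpoly_ring n"
proof -
  have "Poly_Mapping.keys (a + b) \<subseteq> {..<n}"
    if "a \<in> Poly_Mapping.keys p" "b \<in> Poly_Mapping.keys q" for a b
    using that assms keys_add[of a b] unfolding mpoly_ring_def by blast
  then show ?thesis using keys_mult[of p q] by (auto simp: mpoly_ring_def subset_iff)
qed

lemma mpoly_ring_const: "mpoly_const c \<in> mpoly_ring n"
  by (simp add: mpoly_ring_def mpoly_const_def)

lemma mpoly_ring_var: "i < n \<Longrightarrow> mpoly_var i \<in> mpoly_ring n"
  by (simp add: mpoly_ring_def mpoly_var_def)

lemma mpoly_ring_0: "0 \<in> mpoly_ring n"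
  by (simp add: mpoly_ring_def)

lemma mpoly_ring_1: "1 \<in> mpoly_ring n"
  by (simp add: mpoly_ring_def)

lemma mpoly_ring_sum: "(\<And>x. x \<in> A \<Longrightarrow> f x \<in> mpoly_ring n) \<Longrightarrow> sum f A \<in> mpoly_ring n"
  by (induction A rule: infinite_finite_induct) (auto simp: mpoly_ring_0 mpoly_ring_add)

section \<open>Total degree under ring operations and linear substitution\<close>

definition monom_degree :: "(nat \<Rightarrow>\<^sub>0 nat) \<Rightarrow> nat" where
  "monom_degree m = (\<Sum>i\<in>Poly_Mapping.keys m. Poly_Mapping.lookup m i)"

lemma monom_degree_add: "monom_degree (m + m') = monom_degree m + monom_degree m'"
proof -
  have *: "monom_degree l = (\<Sum>i\<in>Poly_Mapping.keys m \<union> Poly_Mapping.keys m'. Poly_Mapping.lookup l i)"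
    if "Poly_Mapping.keys l \<subseteq> Poly_Mapping.keys m \<union> Poly_Mapping.keys m'" for l
    unfolding monom_degree_def using that
    by (intro sum.mono_neutral_left) (auto simp: in_keys_iff)
  show ?thesis
    using keys_add[of m m'] by (subst (1 2 3) *) (auto simp: lookup_add sum.distrib)
qed

lemma total_degree_le_iff:
  "total_degree p \<le> d \<longleftrightarrow> (\<forall>m\<in>Poly_Mapping.keys p. monom_degree m \<le> d)"
  by (auto simp: total_degree_def monom_degree_def)

lemma total_degree_add:
  "total_degree p \<le> d \<Longrightarrow> total_degree q \<le> d \<Longrightarrow> total_degree (p + q) \<le> d"
  unfolding total_degree_le_iff using keys_add[of p q] by blast

lemma total_degree_mult:
  "total_degree p \<le> d \<Longrightarrow> total_degree q \<le> e \<Longrightarrow> total_degree (p * q) \<le> d + e"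
  unfolding total_degree_le_iff using keys_mult[of p q]
  by (fastforce simp: monom_degree_add intro: add_mono)

lemma total_degree_const: "total_degree (mpoly_const c) \<le> d"
  by (simp add: total_degree_le_iff mpoly_const_def monom_degree_def)

lemma total_degree_var: "1 \<le> d \<Longrightarrow> total_degree (mpoly_var i) \<le> d"
  by (simp add: total_degree_le_iff mpoly_var_def monom_degree_def)

lemma total_degree_0: "total_degree 0 \<le> d"
  by (simp add: total_degree_le_iff)

lemma total_degree_1 [simp]: "total_degree 1 = 0"
  by (simp add: total_degree_def)

lemma total_degree_sum:
  "(\<And>x. x \<in> A \<Longrightarrow> total_degree (f x) \<le> d) \<Longrightarrow> total_degree (sum f A) \<le> d"
  by (induction A rule: infinite_finite_induct) (auto simp: total_degree_0 total_degree_add)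

lemma total_degree_prod:
  "(\<And>x. x \<in> A \<Longrightarrow> total_degree (f x) \<le> d x) \<Longrightarrow> total_degree (prod f A) \<le> sum d A"
  by (induction A rule: infinite_finite_induct) (auto intro: total_degree_mult)

lemma total_degree_power: "total_degree p \<le> d \<Longrightarrow> total_degree (p ^ k) \<le> k * d"
    by (induction k) (simp_all add: total_degree_mult)

lemma total_degree_linear_subst:
  assumes "\<And>i. total_degree (t i) \<le> 1" "total_degree p \<le> d"
  shows "total_degree (mpoly_subst mpoly_const t p) \<le> d"
  unfolding mpoly_subst_def
proof (rule total_degree_sum)
  fix m assume m: "m \<in> Poly_Mapping.keys p"
  have "total_degree (\<Prod>i\<in>Poly_Mapping.keys m. t i ^ Poly_Mapping.lookup m i) \<le> monom_degree m"
    unfolding monom_degree_def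
    by (rule total_degree_prod) (metis assms(1) total_degree_power mult.right_neutral)
  then have "total_degree (mpoly_const (Poly_Mapping.lookup p m) *
      (\<Prod>i\<in>Poly_Mapping.keys m. t i ^ Poly_Mapping.lookup m i)) \<le> 0 + monom_degree m"
    by (intro total_degree_mult total_degree_const)
  then show "total_degree (mpoly_const (Poly_Mapping.lookup p m) *
      (\<Prod>i\<in>Poly_Mapping.keys m. t i ^ Poly_Mapping.lookup m i)) \<le> d"
    using m assms(2) by (auto simp: total_degree_le_iff intro: order_trans)
qed

lemma mpoly_ring_subst:
  assumes "\<And>i. t i \<in> mpoly_ring n"
  shows "mpoly_subst mpoly_const t p \<in> mpoly_ring n"
proof -
  have pow: "t i ^ k \<in> mpoly_ring n" for i k
    by (induction k) (auto simp: mpoly_ring_1 mpoly_ring_mult assms)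
  have "(\<Prod>i\<in>A. t i ^ f i) \<in> mpoly_ring n" for A :: "nat set" and f
    by (induction A rule: infinite_finite_induct) (auto simp: mpoly_ring_1 mpoly_ring_mult pow)
  then show ?thesis
    unfolding mpoly_subst_def by (intro mpoly_ring_sum mpoly_ring_mult mpoly_ring_const)
qed

section \<open>Averaging\<close>

lemma GL_simps:
  "carrier (GL n) \<subseteq> carrier_mat n n" "A \<otimes>\<^bsub>GL n\<^esub> B = A * B" "\<one>\<^bsub>GL n\<^esub> = 1\<^sub>m n"
  by (auto simp: GL_def units_of_def ring_mat_def Units_def)

lemma GL_I:
  assumes "A \<in> carrier_mat n n" "B \<in> carrier_mat n n" "A * B = 1\<^sub>m n" "B * A = 1\<^sub>m n"
  shows "A \<in> carrier (GL n)"
  using assms by (auto simp: GL_def units_of_def ring_mat_def Units_def)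

lemma group_GL: "group (GL n)"
  unfolding GL_def by (rule monoid.units_group[OF ring.is_monoid[OF ring_mat]])

locale matrix_rep = group G for G (structure) +
  fixes n :: nat and \<rho> :: "'a \<Rightarrow> 'k::field mat"
  assumes hom: "\<rho> \<in> hom G (GL n)" and finite_carrier: "finite (carrier G)"
begin

lemma rho_carrier: "g \<in> carrier G \<Longrightarrow> \<rho> g \<in> carrier_mat n n"
  using hom GL_simps(1)[of n] by (auto simp: hom_def)

lemma rho_mult: "g \<in> carrier G \<Longrightarrow> h \<in> carrier G \<Longrightarrow> \<rho> (g \<otimes> h) = \<rho> g * \<rho> h"
  using hom by (auto simp: hom_def GL_simps)

lemma rho_one: "\<rho> \<one> = 1\<^sub>m n"
proof -
  interpret group_hom G "GL n" \<rho>
    using hom group_GL by (simp add: group_hom_def group_hom_axioms_def is_group)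
  show ?thesis using hom_one by (simp add: GL_simps)
qed

abbreviation act :: "'a \<Rightarrow> 'k vec \<Rightarrow> 'k vec" where "act g v \<equiv> \<rho> g *\<^sub>v v"

lemma act_closed: "g \<in> carrier G \<Longrightarrow> v \<in> carrier_vec n \<Longrightarrow> act g v \<in> carrier_vec n"
  by (rule mult_mat_vec_carrier[OF rho_carrier])

lemma act_mult: "g \<in> carrier G \<Longrightarrow> h \<in> carrier G \<Longrightarrow> v \<in> carrier_vec n \<Longrightarrow>
    act (g \<otimes> h) v = act g (act h v)"
  by (metis rho_mult rho_carrier assoc_mult_mat_vec)

lemma act_one: "v \<in> carrier_vec n \<Longrightarrow> act \<one> v = v"
  by (simp add: rho_one)

lemma vec_orbit_act:
  assumes "g \<in> carrier G" "v \<in> carrier_vec n"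
  shows "vec_orbit G \<rho> (act g v) = vec_orbit G \<rho> v"
proof -
  have "vec_orbit G \<rho> (act g v) = (\<lambda>h. act (h \<otimes> g) v) ` carrier G"
    unfolding vec_orbit_def using assms by (intro image_cong) (auto simp: act_mult)
  also have "\<dots> = (\<lambda>h. act h v) ` ((\<lambda>h. h \<otimes> g) ` carrier G)"
    by (simp add: image_image)
  also have "(\<lambda>h. h \<otimes> g) ` carrier G = carrier G"
  proof (safe, goal_cases)
    case (2 h)
    then have "h = (h \<otimes> inv g) \<otimes> g" using assms by (simp add: m_assoc)
    then show ?case using assms 2 by blast
  qed (use assms in auto)
  finally show ?thesis by (simp add: vec_orbit_def)
qed

abbreviation lform :: "'a \<Rightarrow> nat \<Rightarrow> 'k mpoly" where
  "lform g i \<equiv> \<Sum>j<n. mpoly_const (\<rho> g $$ (i, j)) * mpoly_var j"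

lemma subst_mpoly_act:
  assumes "comm_ring_hom c" "g \<in> carrier G"
  shows "mpoly_subst c s (mpoly_act G n \<rho> g p) =
    mpoly_subst c (\<lambda>i. \<Sum>j<n. c (\<rho> (inv g) $$ (i, j)) * s j) p"
proof -
  interpret comm_ring_hom c by fact
  show ?thesis
    unfolding mpoly_act_def mpoly_subst_subst
    by (simp add: mpoly_subst_sum mpoly_subst_mult mpoly_subst_const mpoly_subst_var)
qed

lemma mpoly_eval_act:
  assumes "g \<in> carrier G" "p \<in> mpoly_ring n" "v \<in> carrier_vec n"
  shows "mpoly_eval (mpoly_act G n \<rho> g p) v = mpoly_eval p (act (inv g) v)"
  unfolding mpoly_eval_def subst_mpoly_act[OF comm_ring_hom_id assms(1)]
  by (rule mpoly_subst_cong[OF assms(2)])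
    (use assms rho_carrier[of "inv g"] in \<open>auto simp: mult_mat_vec_def scalar_prod_def lessThan_atLeast0\<close>)

text \<open>Substitution composes in the reverse order, and so does the inverse; the two reversals
  cancel and leave a left action.\<close>

lemma mpoly_act_act:
  assumes "g \<in> carrier G" "h \<in> carrier G" "p \<in> mpoly_ring n"
  shows "mpoly_act G n \<rho> h (mpoly_act G n \<rho> g p) = mpoly_act G n \<rho> (h \<otimes> g) p"
proof -
  interpret c: comm_ring_hom "mpoly_const :: 'k \<Rightarrow> _" by (rule comm_ring_hom_mpoly_const)
  have "mpoly_act G n \<rho> h (mpoly_act G n \<rho> g p) =
      mpoly_subst mpoly_const (\<lambda>i. \<Sum>j<n. mpoly_const (\<rho> (inv g) $$ (i, j)) * lform (inv h) j) p"
    unfolding mpoly_act_def[of _ _ _ h] by (rule subst_mpoly_act[OF comm_ring_hom_mpoly_const assms(1)])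
  also have "\<dots> = mpoly_subst mpoly_const (lform (inv (h \<otimes> g))) p"
  proof (rule mpoly_subst_cong[OF assms(3)])
    fix i assume i: "i < n"
    have "\<rho> (inv (h \<otimes> g)) = \<rho> (inv g) * \<rho> (inv h)"
      using assms by (simp add: inv_mult_group rho_mult)
    then have *: "\<rho> (inv (h \<otimes> g)) $$ (i, k) = (\<Sum>j<n. \<rho> (inv g) $$ (i, j) * \<rho> (inv h) $$ (j, k))"
      if "k < n" for k
      using i that rho_carrier[of "inv g"] rho_carrier[of "inv h"] assms
      by (auto simp: times_mat_def scalar_prod_def lessThan_atLeast0)
    have "(\<Sum>j<n. mpoly_const (\<rho> (inv g) $$ (i, j)) * lform (inv h) j) =
        (\<Sum>j<n. \<Sum>k<n. mpoly_const (\<rho> (inv g) $$ (i, j)) * mpoly_const (\<rho> (inv h) $$ (j, k)) * mpoly_var k)"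
      by (simp add: sum_distrib_left mult.assoc)
    also have "\<dots> = (\<Sum>k<n. \<Sum>j<n. mpoly_const (\<rho> (inv g) $$ (i, j)) * mpoly_const (\<rho> (inv h) $$ (j, k)) * mpoly_var k)"
      by (rule sum.swap)
    also have "\<dots> = lform (inv (h \<otimes> g)) i"
      by (intro sum.cong refl) (simp add: * c.hom_sum c.hom_mult sum_distrib_right)
    finally show "(\<Sum>j<n. mpoly_const (\<rho> (inv g) $$ (i, j)) * lform (inv h) j) = lform (inv (h \<otimes> g)) i" .
  qed
  finally show ?thesis by (simp add: mpoly_act_def)
qed

lemma mpoly_act_ring: "mpoly_act G n \<rho> g p \<in> mpoly_ring n"
  unfolding mpoly_act_def
  by (intro mpoly_ring_subst mpoly_ring_sum mpoly_ring_mult mpoly_ring_const mpoly_ring_var) simp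

lemma total_degree_mpoly_act: "total_degree p \<le> d \<Longrightarrow> total_degree (mpoly_act G n \<rho> g p) \<le> d"
  unfolding mpoly_act_def
  by (intro total_degree_linear_subst total_degree_sum)
    (use total_degree_mult[OF total_degree_const[of _ 0] total_degree_var[of 1]] in auto)

text \<open>The plain sum over the group, without division by the order; that factor is cancelled in
  \<open>invariant_fun_eq\<close>.\<close>

definition reynolds :: "'k mpoly \<Rightarrow> 'k mpoly" where
  "reynolds p = (\<Sum>g\<in>carrier G. mpoly_act G n \<rho> g p)"

lemma reynolds_invariant:
  assumes "p \<in> mpoly_ring n"
  shows "reynolds p \<in> invariants G n \<rho>"
  unfolding invariants_def
proof safe
  show "reynolds p \<in> mpoly_ring n"
    unfolding reynolds_def by (intro mpoly_ring_sum mpoly_act_ring)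
next
  fix h assume h: "h \<in> carrier G"
  interpret c: comm_ring_hom "mpoly_const :: 'k \<Rightarrow> _" by (rule comm_ring_hom_mpoly_const)
  have "mpoly_act G n \<rho> h (reynolds p) = (\<Sum>g\<in>carrier G. mpoly_act G n \<rho> h (mpoly_act G n \<rho> g p))"
    unfolding reynolds_def mpoly_act_def[of _ _ _ h] by (rule c.mpoly_subst_sum)
  also have "\<dots> = (\<Sum>g\<in>carrier G. mpoly_act G n \<rho> (h \<otimes> g) p)"
    using h assms by (intro sum.cong) (auto simp: mpoly_act_act)
  also have "\<dots> = reynolds p"
    unfolding reynolds_def
    by (rule sum.reindex_bij_witness[of _ "\<lambda>g. inv h \<otimes> g" "\<lambda>g. h \<otimes> g"])
      (use h in \<open>auto simp: m_assoc[symmetric]\<close>)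
  finally show "mpoly_act G n \<rho> h (reynolds p) = reynolds p" .
qed

text \<open>Only the values on \<open>carrier_vec n\<close> count. Over a finite field many
  polynomials represent the same function, so \<open>d\<close> bounds the degree of one suitable
  representative.\<close>

definition poly_funs :: "nat \<Rightarrow> ('k vec \<Rightarrow> 'k) set" where
  "poly_funs d = {h. \<exists>p\<in>mpoly_ring n. total_degree p \<le> d \<and> (\<forall>v\<in>carrier_vec n. h v = mpoly_eval p v)}"

definition invariant_fun :: "('k vec \<Rightarrow> 'k) \<Rightarrow> bool" where
  "invariant_fun h \<longleftrightarrow> (\<forall>g\<in>carrier G. \<forall>u\<in>carrier_vec n. h (act g u) = h u)"

text \<open>A polynomial that represents an invariant function need not be invariant itself. Its sum
  over the group is a formal invariant of no larger degree, and the value of this sum is the order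
  of the group times the value of \<open>h\<close>.\<close>

lemma invariant_fun_eq:
  assumes ord: "of_nat (Coset.order G) \<noteq> (0::'k)"
    and eq: "\<And>f. f \<in> invariants G n \<rho> \<Longrightarrow> total_degree f \<le> d \<Longrightarrow> mpoly_eval f v = mpoly_eval f w"
    and h: "h \<in> poly_funs d" "invariant_fun h"
    and v: "v \<in> carrier_vec n" and w: "w \<in> carrier_vec n"
  shows "h v = h w"
proof -
  interpret c: comm_ring_hom "\<lambda>a::'k. a" by (rule comm_ring_hom_id)
  obtain p where p: "p \<in> mpoly_ring n" "total_degree p \<le> d"
    and hp: "\<And>v. v \<in> carrier_vec n \<Longrightarrow> h v = mpoly_eval p v"
    using h(1) by (auto simp: poly_funs_def)
  have "total_degree (reynolds p) \<le> d"
    unfolding reynolds_def by (intro total_degree_sum total_degree_mpoly_act p)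
  then have *: "mpoly_eval (reynolds p) v = mpoly_eval (reynolds p) w"
    by (rule eq[OF reynolds_invariant[OF p(1)]])
  have avg: "mpoly_eval (reynolds p) u = of_nat (Coset.order G) * h u" if u: "u \<in> carrier_vec n" for u
  proof -
    have "mpoly_eval (reynolds p) u = (\<Sum>g\<in>carrier G. mpoly_eval (mpoly_act G n \<rho> g p) u)"
      unfolding reynolds_def mpoly_eval_def by (rule c.mpoly_subst_sum)
    also have "\<dots> = (\<Sum>g\<in>carrier G. h u)"
    proof (rule sum.cong[OF refl])
      fix g assume g: "g \<in> carrier G"
      have "mpoly_eval (mpoly_act G n \<rho> g p) u = mpoly_eval p (act (inv g) u)"
        by (rule mpoly_eval_act[OF g p(1) u])
      also have "\<dots> = h (act (inv g) u)"
        by (rule hp[OF act_closed[OF inv_closed[OF g] u], symmetric])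
      also have "\<dots> = h u"
        using h(2) inv_closed[OF g] u unfolding invariant_fun_def by blast
      finally show "mpoly_eval (mpoly_act G n \<rho> g p) u = h u" .
    qed
    also have "\<dots> = of_nat (Coset.order G) * h u"
      by (simp only: sum_constant Coset.order_def)
    finally show ?thesis .
  qed
  have "of_nat (Coset.order G) * h v = of_nat (Coset.order G) * h w"
    using * unfolding avg[OF v] avg[OF w] .
  then show ?thesis
    by (rule mult_left_cancel[OF ord, THEN iffD1])
qed

section \<open>Closure properties of polynomial functions\<close>

lemma poly_funs_mono: "h \<in> poly_funs d \<Longrightarrow> d \<le> e \<Longrightarrow> h \<in> poly_funs e"
  unfolding poly_funs_def by (auto intro: le_trans)

lemma poly_funs_const: "(\<lambda>_. c) \<in> poly_funs d"
proof -
  interpret c: comm_ring_hom "\<lambda>a::'k. a" by (rule comm_ring_hom_id)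
  show ?thesis unfolding poly_funs_def mpoly_eval_def
    using mpoly_ring_const[of c n] total_degree_const[of c d] c.mpoly_subst_const[of _ c]
    by (auto intro!: bexI[of _ "mpoly_const c"])
qed

lemma poly_funs_coord: "i < n \<Longrightarrow> (\<lambda>v. v $ i) \<in> poly_funs 1"
proof -
  interpret c: comm_ring_hom "\<lambda>a::'k. a" by (rule comm_ring_hom_id)
  assume "i < n"
  then show ?thesis unfolding poly_funs_def mpoly_eval_def
    using mpoly_ring_var[of i n] total_degree_var[of 1 i] c.mpoly_subst_var[of _ i]
    by (auto intro!: bexI[of _ "mpoly_var i"])
qed

lemma poly_funs_add:
  assumes "f \<in> poly_funs d" "g \<in> poly_funs d"
  shows "(\<lambda>v. f v + g v) \<in> poly_funs d"
proof -
  interpret c: comm_ring_hom "\<lambda>a::'k. a" by (rule comm_ring_hom_id)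
  obtain p q where p: "p \<in> mpoly_ring n" "total_degree p \<le> d"
      "\<And>v. v \<in> carrier_vec n \<Longrightarrow> f v = mpoly_eval p v"
    and q: "q \<in> mpoly_ring n" "total_degree q \<le> d"
      "\<And>v. v \<in> carrier_vec n \<Longrightarrow> g v = mpoly_eval q v"
    using assms unfolding poly_funs_def by blast
  have "f v + g v = mpoly_eval (p + q) v" if "v \<in> carrier_vec n" for v
    using that by (simp add: p q mpoly_eval_def c.mpoly_subst_add)
  then show ?thesis
    unfolding poly_funs_def
    using mpoly_ring_add[OF p(1) q(1)] total_degree_add[OF p(2) q(2)] by blast
qed

lemma poly_funs_mult:
  assumes "f \<in> poly_funs d" "g \<in> poly_funs e"
  shows "(\<lambda>v. f v * g v) \<in> poly_funs (d + e)"
proof -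
  interpret c: comm_ring_hom "\<lambda>a::'k. a" by (rule comm_ring_hom_id)
  obtain p q where p: "p \<in> mpoly_ring n" "total_degree p \<le> d"
      "\<And>v. v \<in> carrier_vec n \<Longrightarrow> f v = mpoly_eval p v"
    and q: "q \<in> mpoly_ring n" "total_degree q \<le> e"
      "\<And>v. v \<in> carrier_vec n \<Longrightarrow> g v = mpoly_eval q v"
    using assms unfolding poly_funs_def by blast
  have "f v * g v = mpoly_eval (p * q) v" if "v \<in> carrier_vec n" for v
    using that by (simp add: p q mpoly_eval_def c.mpoly_subst_mult)
  then show ?thesis
    unfolding poly_funs_def
    using mpoly_ring_mult[OF p(1) q(1)] total_degree_mult[OF p(2) q(2)] by blast
qed

lemma poly_funs_scale: "f \<in> poly_funs d \<Longrightarrow> (\<lambda>v. c * f v) \<in> poly_funs d"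
  using poly_funs_mult[OF poly_funs_const[of c 0]] by simp

lemma poly_funs_diff: "f \<in> poly_funs d \<Longrightarrow> g \<in> poly_funs d \<Longrightarrow> (\<lambda>v. f v - g v) \<in> poly_funs d"
  using poly_funs_add[OF _ poly_funs_scale[of g d "-1"], of f] by simp

lemma poly_funs_sum:
  "(\<And>x. x \<in> A \<Longrightarrow> f x \<in> poly_funs d) \<Longrightarrow> (\<lambda>v. \<Sum>x\<in>A. f x v) \<in> poly_funs d"
  by (induction A rule: infinite_finite_induct) (auto simp: poly_funs_const poly_funs_add)

lemma poly_funs_act:
  assumes "f \<in> poly_funs d" "g \<in> carrier G"
  shows "(\<lambda>v. f (act g v)) \<in> poly_funs d"
proof -
  obtain p where p: "p \<in> mpoly_ring n" "total_degree p \<le> d"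
    and fp: "\<And>v. v \<in> carrier_vec n \<Longrightarrow> f v = mpoly_eval p v"
    using assms(1) by (auto simp: poly_funs_def)
  have "f (act g v) = mpoly_eval (mpoly_act G n \<rho> (inv g) p) v" if "v \<in> carrier_vec n" for v
    using that assms p by (simp add: mpoly_eval_act act_closed fp)
  then show ?thesis
    unfolding poly_funs_def using mpoly_act_ring[of "inv g" p] total_degree_mpoly_act[OF p(2)] by blast
qed

end

section \<open>Hurwitz units\<close>

lemma det_2:
  assumes "A \<in> carrier_mat 2 2"
  shows "det A = A $$ (0, 0) * A $$ (1, 1) - A $$ (0, 1) * A $$ (1, 0)"
  using assms
  by (subst laplace_expansion_row[OF assms, of 0])
    (auto simp: numeral_2_eq_2 cofactor_def mat_delete_def det_single)

lemma det_3:
  assumes "A \<in> carrier_mat 3 3"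
  shows "det A = A $$ (0, 0) * (A $$ (1, 1) * A $$ (2, 2) - A $$ (1, 2) * A $$ (2, 1))
    - A $$ (0, 1) * (A $$ (1, 0) * A $$ (2, 2) - A $$ (1, 2) * A $$ (2, 0))
    + A $$ (0, 2) * (A $$ (1, 0) * A $$ (2, 1) - A $$ (1, 1) * A $$ (2, 0))"
  using assms
  by (subst laplace_expansion_row[OF assms, of 0])
    (auto simp: numeral_3_eq_3 numeral_2_eq_2 cofactor_def mat_delete_def det_2[unfolded numeral_2_eq_2] algebra_simps)

lemma mat_2_eqI:
  assumes "A \<in> carrier_mat 2 2" "B \<in> carrier_mat 2 2"
    "A $$ (0, 0) = B $$ (0, 0)" "A $$ (0, 1) = B $$ (0, 1)"
    "A $$ (1, 0) = B $$ (1, 0)" "A $$ (1, 1) = B $$ (1, 1)"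
  shows "A = B"
  using assms by (intro eq_matI) (auto simp: less_Suc_eq numeral_2_eq_2)

definition mat2 :: "'a \<Rightarrow> 'a \<Rightarrow> 'a \<Rightarrow> 'a \<Rightarrow> 'a mat" where
  "mat2 a b c d = mat 2 2 (\<lambda>(i, j). if i = 0 then if j = 0 then a else b else if j = 0 then c else d)"

lemma mat2_simps [simp]:
  "mat2 a b c d \<in> carrier_mat 2 2"
  "mat2 a b c d $$ (0, 0) = a" "mat2 a b c d $$ (0, Suc 0) = b"
  "mat2 a b c d $$ (Suc 0, 0) = c" "mat2 a b c d $$ (Suc 0, Suc 0) = d"
  "dim_row (mat2 a b c d) = 2" "dim_col (mat2 a b c d) = 2"
  by (auto simp: mat2_def)

lemma mat2_eq_iff [simp]: "mat2 a b c d = mat2 a' b' c' d' \<longleftrightarrow> a = a' \<and> b = b' \<and> c = c' \<and> d = d'"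
  by (metis mat2_simps)

lemma mat2_eta: "A \<in> carrier_mat 2 2 \<Longrightarrow> A = mat2 (A $$ (0, 0)) (A $$ (0, 1)) (A $$ (1, 0)) (A $$ (1, 1))"
  by (rule mat_2_eqI) auto

lemma mat2_mult: "mat2 a b c d * mat2 a' b' c' d' =
    mat2 (a * a' + b * c') (a * b' + b * d') (c * a' + d * c') (c * b' + d * d' :: 'a::comm_ring_1)"
  by (rule mat_2_eqI) (auto simp: scalar_prod_def numeral_2_eq_2)

lemma mat2_one: "mat2 1 0 0 1 = 1\<^sub>m 2"
  by (rule mat_2_eqI) auto

lemma det_mat2: "det (mat2 a b c d) = a * d - b * c"
  by (subst det_2) auto

type_synonym quat = "int \<times> int \<times> int \<times> int"

text \<open>The quadruple \<open>(a, b, c, d)\<close> stands for the quaternion \<open>(a + b i + c j + d k) / 2\<close>.\<close>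

definition hurwitz_units :: "quat list" where
  "hurwitz_units =
     [(2, 0, 0, 0), (-2, 0, 0, 0), (0, 2, 0, 0), (0, -2, 0, 0),
      (0, 0, 2, 0), (0, 0, -2, 0), (0, 0, 0, 2), (0, 0, 0, -2),
      (1, 1, 1, 1), (1, 1, 1, -1), (1, 1, -1, 1), (1, 1, -1, -1),
      (1, -1, 1, 1), (1, -1, 1, -1), (1, -1, -1, 1), (1, -1, -1, -1),
      (-1, 1, 1, 1), (-1, 1, 1, -1), (-1, 1, -1, 1), (-1, 1, -1, -1),
      (-1, -1, 1, 1), (-1, -1, 1, -1), (-1, -1, -1, 1), (-1, -1, -1, -1)]"

fun quat_dbl_mult :: "quat \<Rightarrow> quat \<Rightarrow> quat" where
  "quat_dbl_mult (a, b, c, d) (a', b', c', d') =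
     (a * a' - b * b' - c * c' - d * d', a * b' + b * a' + c * d' - d * c',
      a * c' - b * d' + c * a' + d * b', a * d' + b * c' - c * b' + d * a')"

fun quat_half :: "quat \<Rightarrow> quat" where
  "quat_half (a, b, c, d) = (a div 2, b div 2, c div 2, d div 2)"

fun quat_even :: "quat \<Rightarrow> bool" where
  "quat_even (a, b, c, d) \<longleftrightarrow> even a \<and> even b \<and> even c \<and> even d"

definition quat_mult :: "quat \<Rightarrow> quat \<Rightarrow> quat" where
  "quat_mult x y = quat_half (quat_dbl_mult x y)"

fun quat_conj :: "quat \<Rightarrow> quat" where
  "quat_conj (a, b, c, d) = (a, -b, -c, -d)"

text \<open>Since (x / 2) (y / 2) = (x y / 2) / 2, the doubled coordinates of a product are half of
  \<open>quat_dbl_mult\<close>. The table records that these numbers are even, so that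
  \<open>div\<close> is exact and commutes with the passage to any ring containing one half.\<close>

lemma hurwitz_table:
  "list_all (\<lambda>x. quat_conj x \<in> set hurwitz_units \<and> quat_mult x (quat_conj x) = (2, 0, 0, 0) \<and>
     quat_mult (quat_conj x) x = (2, 0, 0, 0) \<and>
     list_all (\<lambda>y. quat_even (quat_dbl_mult x y) \<and> quat_mult x y \<in> set hurwitz_units) hurwitz_units)
   hurwitz_units"
  by code_simp

lemma quat_mult_closed:
  "x \<in> set hurwitz_units \<Longrightarrow> y \<in> set hurwitz_units \<Longrightarrow> quat_mult x y \<in> set hurwitz_units"
  using hurwitz_table by (simp add: list_all_iff)

lemma quat_mult_even:
  "x \<in> set hurwitz_units \<Longrightarrow> y \<in> set hurwitz_units \<Longrightarrow> quat_even (quat_dbl_mult x y)"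
  using hurwitz_table by (simp add: list_all_iff)

lemma quat_conj_unit:
  assumes "x \<in> set hurwitz_units"
  shows "quat_conj x \<in> set hurwitz_units" "quat_mult x (quat_conj x) = (2, 0, 0, 0)"
    "quat_mult (quat_conj x) x = (2, 0, 0, 0)"
  using hurwitz_table assms by (simp_all add: list_all_iff)

text \<open>
  If \<open>p\<^sup>2 + r\<^sup>2 = - 1\<close>, the matrices \<open>[[0, - 1], [1, 0]]\<close> and \<open>[[p, r], [r, - p]]\<close> anticommute and have
  square \<open>- 1\<close>, so they represent the quaternions \<open>i\<close> and \<open>j\<close>. Here \<open>h\<close> is one half.
\<close>
fun quat_mat :: "'a::comm_ring_1 \<Rightarrow> 'a \<Rightarrow> 'a \<Rightarrow> quat \<Rightarrow> 'a mat" where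
  "quat_mat h p r (a, b, c, d) =
     mat2 (h * (of_int a + of_int c * p - of_int d * r)) (h * (- of_int b + of_int c * r + of_int d * p))
          (h * (of_int b + of_int c * r + of_int d * p)) (h * (of_int a - of_int c * p + of_int d * r))"

lemma quat_mat_carrier [simp]: "quat_mat h p r x \<in> carrier_mat 2 2"
  by (cases x) simp

locale quat_matrices =
  fixes h p r :: "'a::comm_ring_1"
  assumes half: "2 * h = 1" and pr: "p * p + r * r = - 1"
begin

lemma of_int_half: "even e \<Longrightarrow> of_int (e div 2) = h * of_int e"
proof -
  assume "even e"
  then have "of_int e = 2 * (of_int (e div 2) :: 'a)"
    by (metis dvd_mult_div_cancel of_int_mult of_int_numeral)
  then show ?thesis by (metis half mult.assoc mult.commute mult_1)
qed

lemma quat_mat_mult: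
  assumes "x \<in> set hurwitz_units" "y \<in> set hurwitz_units"
  shows "quat_mat h p r (quat_mult x y) = quat_mat h p r x * quat_mat h p r y"
proof -
  obtain a b c d where x: "x = (a, b, c, d)" by (cases x)
  obtain a' b' c' d' where y: "y = (a', b', c', d')" by (cases y)
  have ev: "quat_even (quat_dbl_mult x y)" using quat_mult_even assms .
  have pp: "p * p = - 1 - r * r" using pr by (simp add: algebra_simps eq_diff_eq)
  have pp': "p * (p * z) = - z - r * (r * z)" for z
    unfolding mult.assoc[symmetric] pp by (simp add: algebra_simps)
  \<comment> \<open>\<open>of_int\<close> must not be distributed before \<open>of_int_half\<close>
    has turned every halved entry into a multiple of \<open>h\<close>; the second simplification is
    then an identity of polynomials modulo p^2 + r^2 = -1.\<close>
  show ?thesis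
    using ev unfolding x y quat_mult_def
    by (simp add: of_int_half mat2_mult del: of_int_mult of_int_add of_int_diff)
      (simp add: algebra_simps pp pp')
qed

lemma quat_mat_one: "quat_mat h p r (2, 0, 0, 0) = 1\<^sub>m 2"
  using half by (simp add: mat2_one mult.commute)

lemma quat_mat_GL: "x \<in> set hurwitz_units \<Longrightarrow> quat_mat h p r x \<in> carrier (GL 2)"
  by (rule GL_I[of _ _ "quat_mat h p r (quat_conj x)"])
    (auto simp: quat_mat_mult[symmetric] quat_conj_unit quat_mat_one simp del: quat_mat.simps)

end

section \<open>The binary tetrahedral group\<close>

lemma mat_adjoint_mat2: "mat_adjoint (mat2 u v w z) = mat2 (cnj u) (cnj w) (cnj v) (cnj z)"
  by (rule mat_2_eqI) (auto simp: mat_adjoint_def mat_of_rows_def cols_def carrier_matI)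

lemma SU_2_iff: "U \<in> carrier (SU 2) \<longleftrightarrow> (\<exists>a b c d :: real. a\<^sup>2 + b\<^sup>2 + c\<^sup>2 + d\<^sup>2 = 1 \<and>
    U = mat2 (Complex a c) (Complex (- b) d) (Complex b d) (Complex a (- c)))"
proof -
  show ?thesis
  proof
    assume U: "U \<in> carrier (SU 2)"
    then have "U \<in> carrier_mat 2 2" by (simp add: SU_def)
    then obtain u v w z where uv: "U = mat2 u v w z" using mat2_eta by blast
    have det: "u * z - v * w = 1" and 1: "u * cnj u + v * cnj v = 1" and 0: "z * cnj v = - w * cnj u"
      using U unfolding uv by (auto simp: SU_def mat_adjoint_mat2 mat2_mult det_mat2 mat2_one[symmetric] eq_neg_iff_add_eq_0 add.commute)
    \<comment> \<open>Multiplying by the squared norm 1 of the first row, then using its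
      orthogonality to the second row, isolates the determinant; the same device below gives
      \<open>w\<close>.\<close>
    have "z * (u * cnj u + v * cnj v) = z * u * cnj u + v * (z * cnj v)" by (simp add: algebra_simps)
    also have "\<dots> = cnj u * (u * z - v * w)" unfolding 0 by (simp add: algebra_simps)
    finally have "z = cnj u" by (simp only: det 1 mult_1_right)
    have "w * (u * cnj u + v * cnj v) = w * v * cnj v - u * (- w * cnj u)" by (simp add: algebra_simps)
    also have "\<dots> = - cnj v * (u * z - v * w)" unfolding 0[symmetric] by (simp add: algebra_simps)
    finally have "w = - cnj v" by (simp only: det 1 mult_1_right)
    note \<open>z = cnj u\<close> \<open>w = - cnj v\<close>
    moreover have "(Re u)\<^sup>2 + (Re v)\<^sup>2 + (Im u)\<^sup>2 + (Im v)\<^sup>2 = 1"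
      using arg_cong[OF 1, of Re] by (simp add: power2_eq_square)
    ultimately show "\<exists>a b c d. a\<^sup>2 + b\<^sup>2 + c\<^sup>2 + d\<^sup>2 = 1 \<and>
        U = mat2 (Complex a c) (Complex (- b) d) (Complex b d) (Complex a (- c))"
      unfolding uv
      by (intro exI[of _ "Re u"] exI[of _ "- Re v"] exI[of _ "Im u"] exI[of _ "Im v"])
        (auto simp: complex_eq_iff)
  next
    assume "\<exists>a b c d. a\<^sup>2 + b\<^sup>2 + c\<^sup>2 + d\<^sup>2 = 1 \<and>
        U = mat2 (Complex a c) (Complex (- b) d) (Complex b d) (Complex a (- c))"
    then show "U \<in> carrier (SU 2)"
      by (auto simp: SU_def mat_adjoint_mat2 mat2_mult det_mat2 mat2_one[symmetric] complex_eq_iff power2_eq_square algebra_simps)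
  qed
qed

definition mat3 :: "'a list \<Rightarrow> 'a mat" where
  "mat3 xs = mat 3 3 (\<lambda>(i, j). xs ! (3 * i + j))"

lemma mat3_simps [simp]:
  "mat3 xs \<in> carrier_mat 3 3" "dim_row (mat3 xs) = 3" "dim_col (mat3 xs) = 3"
  "i < 3 \<Longrightarrow> j < 3 \<Longrightarrow> mat3 xs $$ (i, j) = xs ! (3 * i + j)"
  by (auto simp: mat3_def)

lemma all_less_3: "(\<forall>i<3. P i) \<longleftrightarrow> P 0 \<and> P 1 \<and> P (2::nat)"
  by (auto simp: numeral_3_eq_3 numeral_2_eq_2 less_Suc_eq)

lemma mat_3_eqI:
  assumes "A \<in> carrier_mat 3 3" "B \<in> carrier_mat 3 3"
    "\<forall>i<3. \<forall>j<3. A $$ (i, j) = B $$ (i, j)"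
  shows "A = B"
  using assms by (intro eq_matI) auto

text \<open>The quaternion units i, j, k are \<open>- \<i>\<close> times \<open>pauli 1\<close>,
  \<open>\<i>\<close> times \<open>pauli 2\<close> and \<open>\<i>\<close> times
  \<open>pauli 0\<close>. This is therefore the classical rotation matrix of a unit quaternion, with
  permuted axes and one axis reversed.\<close>

lemma spin_cover_mat2:
  "spin_cover (mat2 (Complex a c) (Complex (- b) d) (Complex b d) (Complex a (- c))) =
    mat3 [a\<^sup>2 - b\<^sup>2 - c\<^sup>2 + d\<^sup>2, 2 * (a * c - b * d), 2 * (a * b + c * d),
          - 2 * (a * c + b * d), a\<^sup>2 + b\<^sup>2 - c\<^sup>2 - d\<^sup>2, 2 * (a * d - b * c),
          2 * (c * d - a * b), - 2 * (a * d + b * c), a\<^sup>2 - b\<^sup>2 + c\<^sup>2 - d\<^sup>2]"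
proof -
  have pauli: "pauli 0 = mat2 0 1 1 0" "pauli (Suc 0) = mat2 0 (- \<i>) \<i> 0" "pauli 2 = mat2 1 0 0 (- 1)"
    by (auto simp: pauli_def mat_of_rows_list_def mat2_def intro!: eq_matI simp: less_Suc_eq numeral_2_eq_2)
  have sum2: "(\<Sum>k<2::nat. f k) = f 0 + f (Suc 0)" for f :: "nat \<Rightarrow> complex"
    by (simp add: numeral_2_eq_2)
  show ?thesis
    by (rule mat_3_eqI)
      (simp_all add: spin_cover_def all_less_3 mat_adjoint_mat2 pauli mat2_mult sum2 power2_eq_square field_simps)
qed

definition tetra_point :: "real \<Rightarrow> real \<Rightarrow> real \<Rightarrow> bool" where
  "tetra_point x y z \<longleftrightarrow> (x, y, z) \<in> {(1, 1, 1), (1, - 1, - 1), (- 1, 1, - 1), (- 1, - 1, 1)}"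

text \<open>
  A linear map sending the first three vertices to \<open>s\<close>, \<open>t\<close>, \<open>u\<close> has columns \<open>(s + t) / 2\<close>,
  \<open>(s + u) / 2\<close> and \<open>- (t + u) / 2\<close>, because the four vertices sum to zero. The entries of the
  rotation attached to a unit quaternion determine all products of two of its coefficients.
\<close>
lemma rotation_products:
  fixes a b c d :: real
  assumes "tetra_point s0 s1 s2" "tetra_point t0 t1 t2" "tetra_point u0 u1 u2"
    and "4 * a\<^sup>2 = 1 + (s0 + t0) / 2 + (s1 + u1) / 2 - (t2 + u2) / 2"
    and "4 * b\<^sup>2 = 1 - (s0 + t0) / 2 + (s1 + u1) / 2 + (t2 + u2) / 2"
    and "4 * c\<^sup>2 = 1 - (s0 + t0) / 2 - (s1 + u1) / 2 - (t2 + u2) / 2"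
    and "4 * d\<^sup>2 = 1 + (s0 + t0) / 2 - (s1 + u1) / 2 + (t2 + u2) / 2"
    and "4 * (a * c) = (s0 + u0) / 2 - (s1 + t1) / 2"
    and "4 * (a * b) = - (t0 + u0) / 2 - (s2 + t2) / 2"
    and "4 * (a * d) = - (t1 + u1) / 2 - (s2 + u2) / 2"
    and "4 * (b * d) = - (s0 + u0) / 2 - (s1 + t1) / 2"
    and "4 * (c * d) = - (t0 + u0) / 2 + (s2 + t2) / 2"
    and "4 * (b * c) = (t1 + u1) / 2 - (s2 + u2) / 2"
  shows "(2 * a, 2 * b, 2 * c, 2 * d) \<in>
    (\<lambda>(a, b, c, d). (of_int a, of_int b, of_int c, of_int d)) ` set hurwitz_units"
proof -
  let ?sq = "\<lambda>x y z w. ((2 * a)\<^sup>2 = x \<and> (2 * b)\<^sup>2 = y \<and> (2 * c)\<^sup>2 = z \<and> (2 * d)\<^sup>2 = (w::real))"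
  define A B C D AB AC AD BC BD CD where defs: "A = 4 * a\<^sup>2" "B = 4 * b\<^sup>2" "C = 4 * c\<^sup>2" "D = 4 * d\<^sup>2"
    "AB = 4 * (a * b)" "AC = 4 * (a * c)" "AD = 4 * (a * d)" "BC = 4 * (b * c)"
    "BD = 4 * (b * d)" "CD = 4 * (c * d)"
  have rel: "A * B = AB * AB" "A * C = AC * AC" "A * D = AD * AD" "B * C = BC * BC"
      "B * D = BD * BD" "C * D = CD * CD" "A \<ge> 0" "B \<ge> 0" "C \<ge> 0" "D \<ge> 0"
    by (simp_all add: defs power2_eq_square)
  \<comment> \<open>The 64 choices of vertices determine all ten numbers. Nonnegativity and the
    relations saying that the matrix of products has rank one leave only the listed squares.\<close>
  have "(A = 1 \<and> B = 1 \<and> C = 1 \<and> D = 1) \<or> (A = 4 \<and> B = 0 \<and> C = 0 \<and> D = 0) \<or>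
      (A = 0 \<and> B = 4 \<and> C = 0 \<and> D = 0) \<or> (A = 0 \<and> B = 0 \<and> C = 4 \<and> D = 0) \<or>
      (A = 0 \<and> B = 0 \<and> C = 0 \<and> D = 4)"
    using assms(1-3) rel unfolding assms(4-13)[folded defs] tetra_point_def
    by (simp only: insert_iff prod.inject empty_iff simp_thms) (elim disjE; simp)
  then have sq: "?sq 1 1 1 1 \<or> ?sq 4 0 0 0 \<or> ?sq 0 4 0 0 \<or> ?sq 0 0 4 0 \<or> ?sq 0 0 0 4"
    unfolding defs power_mult_distrib by simp
  have sq_iff: "x\<^sup>2 = 1 \<longleftrightarrow> x = 1 \<or> x = - 1" "x\<^sup>2 = 4 \<longleftrightarrow> x = 2 \<or> x = - 2" for x :: real
    using power2_eq_iff[of x 2] by (auto simp: power2_eq_1_iff)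
  have "(x, y, z, w) \<in> (\<lambda>(a, b, c, d). (of_int a, of_int b, of_int c, of_int d)) ` set hurwitz_units"
    if "x\<^sup>2 = 1 \<and> y\<^sup>2 = 1 \<and> z\<^sup>2 = 1 \<and> w\<^sup>2 = 1 \<or> x\<^sup>2 = 4 \<and> y\<^sup>2 = 0 \<and> z\<^sup>2 = 0 \<and> w\<^sup>2 = 0 \<or>
      x\<^sup>2 = 0 \<and> y\<^sup>2 = 4 \<and> z\<^sup>2 = 0 \<and> w\<^sup>2 = 0 \<or> x\<^sup>2 = 0 \<and> y\<^sup>2 = 0 \<and> z\<^sup>2 = 4 \<and> w\<^sup>2 = 0 \<or>
      x\<^sup>2 = 0 \<and> y\<^sup>2 = 0 \<and> z\<^sup>2 = 0 \<and> w\<^sup>2 = 4" for x y z w :: real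
    using that unfolding sq_iff zero_eq_power2 by (elim disjE conjE) (simp_all add: hurwitz_units_def)
  from this[OF sq] show ?thesis .
qed

lemma mat3_mult_vec:
  "mat3 [a, b, c, d, e, f, g, h, i] *\<^sub>v vec_of_list [x, y, z] =
    vec_of_list [a * x + b * y + c * z, d * x + e * y + f * z, g * x + h * y + i * (z::real)]"
  by (rule eq_vecI)
    (auto simp: mult_mat_vec_def scalar_prod_def mat3_def eval_nat_numeral less_Suc_eq vec_of_list_index
      simp del: vec_of_list_Cons)

lemma vec_of_list_eq_iff: "vec_of_list xs = vec_of_list ys \<longleftrightarrow> xs = ys"
  by (metis list_vec)

lemma mat3_mult_transpose:
  "mat3 [a, b, c, d, e, f, g, h, i] * transpose_mat (mat3 [a, b, c, d, e, f, g, h, i]) =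
    mat3 [a * a + b * b + c * c, a * d + b * e + c * f, a * g + b * h + c * i,
      d * a + e * b + f * c, d * d + e * e + f * f, d * g + e * h + f * i,
      g * a + h * b + i * c, g * d + h * e + i * f, g * g + h * h + i * (i::real)]"
proof -
  have "(\<Sum>k\<in>{0..<3}. f k) = f 0 + f 1 + f 2" for f :: "nat \<Rightarrow> real"
    by (simp add: eval_nat_numeral)
  then show ?thesis
    by (intro mat_3_eqI mult_carrier_mat[where n = 3]) (simp_all add: all_less_3 scalar_prod_def)
qed

lemma mat3_one: "mat3 [1, 0, 0, 0, 1, 0, 0, 0, 1] = 1\<^sub>m 3"
  by (rule mat_3_eqI) (auto simp: all_less_3)

text \<open>The twelve rotations of the tetrahedron, row by row: cyclic permutations of the axes
  combined with an even number of sign changes.\<close>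

definition tetra_rotation_entries :: "real list set" where
  "tetra_rotation_entries =
     {[1, 0, 0, 0, 1, 0, 0, 0, 1],
      [- 1, 0, 0, 0, 1, 0, 0, 0, - 1],
      [- 1, 0, 0, 0, - 1, 0, 0, 0, 1],
      [1, 0, 0, 0, - 1, 0, 0, 0, - 1],
      [0, 0, 1, - 1, 0, 0, 0, - 1, 0],
      [0, 1, 0, 0, 0, - 1, - 1, 0, 0],
      [0, - 1, 0, 0, 0, 1, - 1, 0, 0],
      [0, 0, 1, 1, 0, 0, 0, 1, 0],
      [0, 1, 0, 0, 0, 1, 1, 0, 0],
      [0, 0, - 1, - 1, 0, 0, 0, 1, 0],
      [0, 0, - 1, 1, 0, 0, 0, - 1, 0],
      [0, - 1, 0, 0, 0, - 1, 1, 0, 0]}"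

text \<open>This trades the geometric definition for a finite list. A rotation preserving the
  vertices is known from the images of three of them, which gives back the quaternion; conversely
  the 24 units are checked one by one.\<close>

lemma binary_tetrahedral_carrier:
  "carrier binary_tetrahedral = quat_mat (1 / 2) \<i> 0 ` set hurwitz_units"
proof (intro equalityI subsetI)
  fix U assume "U \<in> carrier binary_tetrahedral"
  then have SU: "U \<in> carrier (SU 2)" and R: "spin_cover U \<in> tetrahedral_rotations"
    by (auto simp: binary_tetrahedral_def)
  obtain a b c d where 1: "a\<^sup>2 + b\<^sup>2 + c\<^sup>2 + d\<^sup>2 = 1"
    and U: "U = mat2 (Complex a c) (Complex (- b) d) (Complex b d) (Complex a (- c))"
    using SU unfolding SU_2_iff by blast
  define R00 R01 R02 R10 R11 R12 R20 R21 R22 where Rdefs: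
    "R00 = a\<^sup>2 - b\<^sup>2 - c\<^sup>2 + d\<^sup>2" "R01 = 2 * (a * c - b * d)" "R02 = 2 * (a * b + c * d)"
    "R10 = - 2 * (a * c + b * d)" "R11 = a\<^sup>2 + b\<^sup>2 - c\<^sup>2 - d\<^sup>2" "R12 = 2 * (a * d - b * c)"
    "R20 = 2 * (c * d - a * b)" "R21 = - 2 * (a * d + b * c)" "R22 = a\<^sup>2 - b\<^sup>2 + c\<^sup>2 - d\<^sup>2"
  have img: "mat3 [R00, R01, R02, R10, R11, R12, R20, R21, R22] *\<^sub>v x \<in> tetrahedron_vertices"
    if "x \<in> tetrahedron_vertices" for x
    using R that unfolding tetrahedral_rotations_def U spin_cover_mat2 Rdefs by blast
  have pt: "tetra_point (R00 * x + R01 * y + R02 * z) (R10 * x + R11 * y + R12 * z) (R20 * x + R21 * y + R22 * z)"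
    if "tetra_point x y z" for x y z
    using img[of "vec_of_list [x, y, z]"] that
    by (simp add: mat3_mult_vec tetrahedron_vertices_def tetra_point_def vec_of_list_eq_iff image_iff
        del: vec_of_list_Cons)
  \<comment> \<open>The hypotheses on products are read off the rotation matrix: by the norm
    equation 4 a^2 is 1 plus the trace, 4 a c is \<open>R01 - R10\<close>, and similarly for the
    others.\<close>
  have "(2 * a, 2 * b, 2 * c, 2 * d) \<in>
      (\<lambda>(a, b, c, d). (of_int a, of_int b, of_int c, of_int d)) ` set hurwitz_units"
    by (rule rotation_products[OF pt[of 1 1 1] pt[of 1 "-1" "-1"] pt[of "-1" 1 "-1"]])
      (use 1 in \<open>simp_all add: tetra_point_def Rdefs field_simps\<close>)
  then obtain a' b' c' d' where q: "(a', b', c', d') \<in> set hurwitz_units"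
    "a = of_int a' / 2" "b = of_int b' / 2" "c = of_int c' / 2" "d = of_int d' / 2" by force
  then have "U = quat_mat (1 / 2) \<i> 0 (a', b', c', d')"
    unfolding U by (simp add: complex_eq_iff)
  then show "U \<in> quat_mat (1 / 2) \<i> 0 ` set hurwitz_units" using q(1) by blast
next
  fix U assume "U \<in> quat_mat (1 / 2) \<i> 0 ` set hurwitz_units"
  then obtain a' b' c' d' where q: "(a', b', c', d') \<in> set hurwitz_units"
    and "U = quat_mat (1 / 2) \<i> 0 (a', b', c', d')" by auto
  moreover define a b c d :: real where abcd: "a = of_int a' / 2" "b = of_int b' / 2" "c = of_int c' / 2" "d = of_int d' / 2"
  ultimately have U: "U = mat2 (Complex a c) (Complex (- b) d) (Complex b d) (Complex a (- c))"
    by (simp add: complex_eq_iff)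
  have abcd': "(a, b, c, d) \<in> (\<lambda>(a, b, c, d). (of_int a / 2, of_int b / 2, of_int c / 2, of_int d / 2)) ` set hurwitz_units"
    using q by (force simp: abcd)
  have 1: "a\<^sup>2 + b\<^sup>2 + c\<^sup>2 + d\<^sup>2 = 1"
    using abcd' unfolding hurwitz_units_def
    by (simp only: list.set image_insert image_empty insert_iff empty_iff prod.case prod.inject simp_thms)
      (elim disjE conjE; simp only:; simp add: power2_eq_square)
  then have SU: "U \<in> carrier (SU 2)" unfolding SU_2_iff U by blast
  define R where "R = spin_cover U"
  have R: "R \<in> mat3 ` tetra_rotation_entries"
    using abcd' unfolding R_def U spin_cover_mat2 hurwitz_units_def tetra_rotation_entries_def
    by (simp only: list.set image_insert image_empty insert_iff empty_iff prod.case prod.inject simp_thms)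
      (elim disjE conjE; simp only:; simp add: power2_eq_square)
  then have "R \<in> carrier (SO 3)"
    unfolding SO_def tetra_rotation_entries_def image_insert image_empty insert_iff empty_iff simp_thms
    by (elim disjE) (simp_all add: det_3 mat3_mult_transpose mat3_one)
  moreover have "(\<lambda>x. R *\<^sub>v x) ` tetrahedron_vertices = tetrahedron_vertices"
    using R unfolding tetra_rotation_entries_def tetrahedron_vertices_def image_insert image_empty insert_iff empty_iff simp_thms
    by (elim disjE) (simp_all only: mat3_mult_vec mult_1_left mult_zero_left mult_minus_left add_0_left add_0_right
        minus_minus minus_zero insert_commute, (simp add: insert_commute del: vec_of_list_Cons)?)
  ultimately have "spin_cover U \<in> carrier (SO 3) \<and>
      (\<lambda>x. spin_cover U *\<^sub>v x) ` tetrahedron_vertices = tetrahedron_vertices"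
    unfolding R_def by blast
  then have "spin_cover U \<in> tetrahedral_rotations" by (simp add: tetrahedral_rotations_def)
  with SU show "U \<in> carrier binary_tetrahedral" by (simp add: binary_tetrahedral_def)
qed

section \<open>Group structure, order, and the isomorphism with SL_2(F_3)\<close>

interpretation complex: quat_matrices "1 / 2 :: complex" \<i> 0
  by unfold_locales auto

text \<open>In the field with three elements -1 is not a square, but 1 + 1 = -1, and 2 is its own
  inverse. This is why the matrices carry two parameters \<open>p\<close> and
  \<open>r\<close>.\<close>

interpretation mod3: quat_matrices "2 :: 3" 1 1
proof
  have "(4::3) = 1" "(2::3) = - 1" by (simp_all add: bit1.of_int_eq)
  then show "2 * 2 = (1::3)" "1 * 1 + 1 * 1 = - (1::3)" by simp_all
qed

lemma distinct_hurwitz_units: "distinct hurwitz_units"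
  by (simp add: hurwitz_units_def)

abbreviation quat_embed :: "quat \<Rightarrow> complex mat" where
  "quat_embed \<equiv> quat_mat (1 / 2) \<i> 0"

lemma inj_quat_embed: "inj quat_embed"
  by (auto simp: inj_def complex_eq_iff)

lemma binary_tetrahedral_simps:
  "A \<otimes>\<^bsub>binary_tetrahedral\<^esub> B = A * B" "\<one>\<^bsub>binary_tetrahedral\<^esub> = 1\<^sub>m 2"
  by (simp_all add: binary_tetrahedral_def SU_def GL_simps)

lemma card_binary_tetrahedral: "card (carrier binary_tetrahedral) = 24"
proof -
  have "card (carrier binary_tetrahedral) = card (set hurwitz_units)"
    unfolding binary_tetrahedral_carrier
    by (rule card_image) (use inj_quat_embed inj_on_subset in blast)
  also have "\<dots> = 24"
    by (subst distinct_card[OF distinct_hurwitz_units]) (simp add: hurwitz_units_def)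
  finally show ?thesis .
qed

lemma group_binary_tetrahedral: "group binary_tetrahedral"
proof -
  have "subgroup (carrier binary_tetrahedral) (GL 2)"
  proof (rule group.subgroupI[OF group_GL])
    show "carrier binary_tetrahedral \<subseteq> carrier (GL 2)"
      unfolding binary_tetrahedral_carrier using complex.quat_mat_GL by blast
    show "carrier binary_tetrahedral \<noteq> {}" using card_binary_tetrahedral by auto
  next
    fix A assume "A \<in> carrier binary_tetrahedral"
    then obtain x where x: "x \<in> set hurwitz_units" "A = quat_embed x"
      unfolding binary_tetrahedral_carrier by blast
    have "quat_embed (quat_conj x) * quat_embed x = 1\<^sub>m 2"
      unfolding complex.quat_mat_mult[OF quat_conj_unit(1)[OF x(1)] x(1), symmetric] quat_conj_unit(3)[OF x(1)]
      by (rule complex.quat_mat_one)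
    then have "inv\<^bsub>GL 2\<^esub> A = quat_embed (quat_conj x)"
      unfolding x(2) by (intro group.inv_equality[OF group_GL] complex.quat_mat_GL x quat_conj_unit) (simp only: GL_simps)
    then show "inv\<^bsub>GL 2\<^esub> A \<in> carrier binary_tetrahedral"
      unfolding binary_tetrahedral_carrier using quat_conj_unit(1)[OF x(1)] by simp
  next
    fix A B assume "A \<in> carrier binary_tetrahedral" "B \<in> carrier binary_tetrahedral"
    then obtain x y where x: "x \<in> set hurwitz_units" "A = quat_embed x"
      and y: "y \<in> set hurwitz_units" "B = quat_embed y"
      unfolding binary_tetrahedral_carrier by blast
    then show "A \<otimes>\<^bsub>GL 2\<^esub> B \<in> carrier binary_tetrahedral"
      unfolding binary_tetrahedral_carrier GL_simps x y complex.quat_mat_mult[OF x(1) y(1), symmetric]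
      by (intro imageI quat_mult_closed)
  qed
  then have "group (GL 2\<lparr>carrier := carrier binary_tetrahedral\<rparr>)"
    by (rule subgroup.subgroup_is_group[OF _ group_GL])
  then show ?thesis by (simp add: binary_tetrahedral_def SU_def)
qed

definition quat_of :: "complex mat \<Rightarrow> quat" where
  "quat_of = inv_into UNIV quat_embed"

lemma quat_of_embed [simp]: "quat_of (quat_embed x) = x"
  unfolding quat_of_def by (rule inv_f_f[OF inj_quat_embed])

text \<open>Every choice of parameters gives a representation of the geometric group, because
  \<open>quat_of\<close> recovers the quaternion from the complex matrix. It is used over F_3 for
  the isomorphism and over K for the lower bound.\<close>

lemma (in quat_matrices) quat_mat_hom: "quat_mat h p r \<circ> quat_of \<in> hom binary_tetrahedral (GL 2)"
proof (rule homI)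
  fix A assume "A \<in> carrier binary_tetrahedral"
  then show "(quat_mat h p r \<circ> quat_of) A \<in> carrier (GL 2)"
    unfolding binary_tetrahedral_carrier
    by (auto simp: quat_mat_GL simp del: quat_mat.simps)
next
  fix A B assume "A \<in> carrier binary_tetrahedral" "B \<in> carrier binary_tetrahedral"
  then show "(quat_mat h p r \<circ> quat_of) (A \<otimes>\<^bsub>binary_tetrahedral\<^esub> B) =
      (quat_mat h p r \<circ> quat_of) A \<otimes>\<^bsub>GL 2\<^esub> (quat_mat h p r \<circ> quat_of) B"
    unfolding binary_tetrahedral_carrier
    by (auto simp: GL_simps binary_tetrahedral_simps complex.quat_mat_mult[symmetric] quat_mat_mult simp del: quat_mat.simps)
qed

lemma mod3_cases: "(x::3) = 0 \<or> x = 1 \<or> x = - 1"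
proof -
  obtain z where "x = of_int z" "0 \<le> z" "z < int CARD(3)"
    by (rule bit1.cases[of x])
  then consider "z = 0" | "z = 1" | "z = 2" by force
  then show ?thesis
    using \<open>x = of_int z\<close> by cases simp_all
qed

lemma quat_mat_mod3: "quat_mat 2 1 1 ` set hurwitz_units = {A \<in> carrier_mat 2 2. det A = (1::3)}"
proof (intro equalityI subsetI)
  fix A :: "3 mat" assume "A \<in> quat_mat 2 1 1 ` set hurwitz_units"
  then obtain x where "x \<in> set hurwitz_units" "A = quat_mat 2 1 1 x" by blast
  then show "A \<in> {A \<in> carrier_mat 2 2. det A = 1}"
    by (auto simp: hurwitz_units_def det_mat2)
next
  fix A :: "3 mat" assume A: "A \<in> {A \<in> carrier_mat 2 2. det A = 1}"
  obtain a b c d where abcd: "A = mat2 a b c d" using A mat2_eta by blast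
  then have "a * d - b * c = 1" using A by (simp add: det_mat2)
  then show "A \<in> quat_mat 2 1 1 ` set hurwitz_units"
    unfolding abcd
    using mod3_cases[of a] mod3_cases[of b] mod3_cases[of c] mod3_cases[of d]
    by (elim disjE) (simp_all add: hurwitz_units_def)
qed

lemma inj_quat_mat_mod3: "inj_on (quat_mat 2 1 1 :: quat \<Rightarrow> 3 mat) (set hurwitz_units)"
proof -
  have "distinct (map (quat_mat 2 1 1 :: quat \<Rightarrow> 3 mat) hurwitz_units)"
    by (simp add: hurwitz_units_def)
  then show ?thesis by (simp add: distinct_map)
qed

lemma binary_tetrahedral_iso: "binary_tetrahedral \<cong> (SL 2 :: 3 mat monoid)"
proof -
  let ?f = "(quat_mat 2 1 1 :: _ \<Rightarrow> 3 mat) \<circ> quat_of"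
  have carrier: "carrier (SL 2 :: 3 mat monoid) = quat_mat 2 1 1 ` set hurwitz_units"
    by (simp add: SL_def quat_mat_mod3)
  have "?f \<in> hom binary_tetrahedral (GL 2)" by (rule mod3.quat_mat_hom)
  then have "?f \<in> hom binary_tetrahedral (SL 2)"
    unfolding hom_def carrier binary_tetrahedral_carrier by (auto simp: SL_def simp del: quat_mat.simps)
  moreover have "bij_betw ?f (carrier binary_tetrahedral) (carrier (SL 2))"
    unfolding bij_betw_def carrier binary_tetrahedral_carrier
    using inj_quat_mat_mod3
    by (auto simp: inj_on_def image_image simp del: quat_mat.simps)
  ultimately show ?thesis by (auto simp: is_iso_def iso_def)
qed

section \<open>The upper bound\<close>

text \<open>Products of pairs of coordinates determine a vector up to sign. The sign is the ratio at
  some \<open>p\<close> with \<open>f p\<close> nonzero; if there is none, both families vanish and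
  any sign will do.\<close>

lemma equal_products_imp_sign:
  fixes f g :: "'q \<Rightarrow> 'k::field"
  assumes "\<And>q q'. q \<in> Q \<Longrightarrow> q' \<in> Q \<Longrightarrow> f q * f q' = g q * g q'"
  shows "\<exists>\<epsilon>. \<epsilon> * \<epsilon> = 1 \<and> (\<forall>q\<in>Q. g q = \<epsilon> * f q)"
proof (cases "\<forall>q\<in>Q. f q = 0")
  case True
  then have "\<forall>q\<in>Q. g q = 0" using assms by fastforce
  with True show ?thesis by (intro exI[of _ 1]) auto
next
  case False
  then obtain p where p: "p \<in> Q" "f p \<noteq> 0" by blast
  let ?\<epsilon> = "g p / f p"
  have "g p * g p \<noteq> 0" using assms[OF p(1) p(1)] p(2) by (metis mult_eq_0_iff)
  then have sq: "?\<epsilon> * ?\<epsilon> = 1" using assms[OF p(1) p(1)] by simp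
  moreover have "g q = ?\<epsilon> * f q" if q: "q \<in> Q" for q
  proof -
    have "?\<epsilon> * f q = ?\<epsilon> * (f q * f p) / f p" using p by simp
    also have "\<dots> = ?\<epsilon> * ?\<epsilon> * g q" unfolding assms[OF q p(1)] by simp
    finally show ?thesis using sq by simp
  qed
  ultimately show ?thesis by blast
qed

lemma sign_cases: "\<epsilon> * \<epsilon> = (1::'k::field) \<longleftrightarrow> \<epsilon> = 1 \<or> \<epsilon> = - 1"
  by (rule square_eq_1_iff[unfolded power2_eq_square])

text \<open>Each of the three pairs excludes at most one scalar \<open>t\<close>, and 0, 1, -1, 2
  are four different candidates.\<close>

lemma common_nonzero_combination:
  fixes x y z :: "'k::field"
  assumes "(2::'k) \<noteq> 0" "(3::'k) \<noteq> 0"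
    and "x \<noteq> 0 \<or> x' \<noteq> 0" "y \<noteq> 0 \<or> y' \<noteq> 0" "z \<noteq> 0 \<or> z' \<noteq> 0"
  shows "\<exists>t. x + t * x' \<noteq> 0 \<and> y + t * y' \<noteq> 0 \<and> z + t * z' \<noteq> 0"
proof (rule ccontr)
  assume *: "\<not> ?thesis"
  have uniq: "s = t" if "a \<noteq> 0 \<or> a' \<noteq> 0" "a + s * a' = 0" "a + t * a' = 0" for a a' s t :: 'k
  proof -
    have "s * a' = t * a'" using that(2,3) by (metis add_left_cancel)
    moreover have "a' \<noteq> 0" using that by auto
    ultimately show ?thesis by simp
  qed
  let ?B = "\<lambda>t. x + t * x' = 0 \<or> y + t * y' = 0 \<or> z + t * z' = 0"
  have "?B 0" "?B 1" "?B (- 1)" "?B 2" using * by blast+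
  moreover have "(0::'k) \<noteq> 1" "(0::'k) \<noteq> - 1" "(0::'k) \<noteq> 2" using assms(1) by simp_all
  moreover have "(1::'k) \<noteq> - 1" "(1::'k) \<noteq> 2" "(- 1::'k) \<noteq> 2"
  proof -
    show "(1::'k) \<noteq> - 1"
      using assms(1) unfolding eq_neg_iff_add_eq_0 by simp
    have "(1::'k) \<noteq> 1 + 1" by (metis add_cancel_left_right one_neq_zero)
    then show "(1::'k) \<noteq> 2" unfolding one_add_one .
    show "(- 1::'k) \<noteq> 2"
      using assms(2) unfolding neg_eq_iff_add_eq_0 by simp
  qed
  ultimately show False
    using uniq[OF assms(3)] uniq[OF assms(4)] uniq[OF assms(5)] by metis
qed

text \<open>Here \<open>z\<close> plays the part of -1, \<open>i\<close> and \<open>j\<close>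
  generate Q8, and conjugation by \<open>s\<close> sends \<open>i\<close> to \<open>j\<close>,
  \<open>j\<close> to \<open>i \<otimes> j\<close> and \<open>i \<otimes> j\<close> back to
  \<open>i\<close>. The normal form in \<open>generated\<close> reduces invariance under the group
  to invariance under \<open>i\<close>, \<open>j\<close> and \<open>s\<close>.\<close>

locale tetrahedral_rep = matrix_rep G n \<rho> for G (structure) and n and \<rho> :: "'a \<Rightarrow> 'k::field mat" +
  fixes z i j s :: 'a
  assumes gens: "z \<in> carrier G" "i \<in> carrier G" "j \<in> carrier G" "s \<in> carrier G"
    and zz: "z \<otimes> z = \<one>" and ii: "i \<otimes> i = z" and jj: "j \<otimes> j = z"
    and ji: "j \<otimes> i = z \<otimes> (i \<otimes> j)" and si: "s \<otimes> i = j \<otimes> s" and sj: "s \<otimes> j = i \<otimes> j \<otimes> s"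
    and sss: "s \<otimes> (s \<otimes> s) = \<one>"
    and generated: "\<And>g. g \<in> carrier G \<Longrightarrow>
      \<exists>a\<in>{\<one>, i, j, i \<otimes> j}. \<exists>b\<in>{\<one>, z}. \<exists>c\<in>{\<one>, s, s \<otimes> s}. g = a \<otimes> (b \<otimes> c)"
    and order_nz: "of_nat (Coset.order G) \<noteq> (0::'k)" and two: "(2::'k) \<noteq> 0" and three: "(3::'k) \<noteq> 0"
begin

abbreviation V :: "'k vec set" where "V \<equiv> carrier_vec n"
abbreviation I :: "'k vec \<Rightarrow> 'k vec" where "I \<equiv> act i"
abbreviation J :: "'k vec \<Rightarrow> 'k vec" where "J \<equiv> act j"
abbreviation S :: "'k vec \<Rightarrow> 'k vec" where "S \<equiv> act s"
abbreviation Z :: "'k vec \<Rightarrow> 'k vec" where "Z \<equiv> act z"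

lemma closed: "u \<in> V \<Longrightarrow> I u \<in> V" "u \<in> V \<Longrightarrow> J u \<in> V" "u \<in> V \<Longrightarrow> S u \<in> V" "u \<in> V \<Longrightarrow> Z u \<in> V"
  using gens act_closed by blast+

lemma relations:
  assumes "u \<in> V"
  shows "I (I u) = Z u" "J (J u) = Z u" "J (I u) = Z (I (J u))" "Z (Z u) = u"
    "S (I u) = J (S u)" "S (J u) = I (J (S u))" "S (S (S u)) = u"
proof -
  have m: "act (a \<otimes> b) u = act a (act b u)" if "a \<in> carrier G" "b \<in> carrier G" for a b
    using act_mult that assms by blast
  show "I (I u) = Z u" using m[OF gens(2,2)] ii by simp
  show "J (J u) = Z u" using m[OF gens(3,3)] jj by simp
  show "Z (Z u) = u" using m[OF gens(1,1)] zz act_one assms by simp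
  show "J (I u) = Z (I (J u))" using m[OF gens(3,2)] m[OF gens(2,3)] m[OF gens(1), of "i \<otimes> j"] ji gens by simp
  show "S (I u) = J (S u)" using m[OF gens(4,2)] m[OF gens(3,4)] si by simp
  show "S (J u) = I (J (S u))"
    using m[OF gens(4,3)] m[of "i \<otimes> j" s] act_mult[OF gens(2,3), of "S u"] closed(3) assms sj gens by simp
  show "S (S (S u)) = u" using m[OF gens(4), of "s \<otimes> s"] m[OF gens(4,4)] gens sss act_one assms by simp
qed

lemma central:
  assumes "u \<in> V"
  shows "I (Z u) = Z (I u)" "J (Z u) = Z (J u)" "S (Z u) = Z (S u)"
proof -
  have "I (Z u) = I (I (I u))" "J (Z u) = J (J (J u))" using relations(1,2)[OF assms] by simp_all
  then show "I (Z u) = Z (I u)" "J (Z u) = Z (J u)"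
    using relations(1)[OF closed(1)[OF assms]] relations(2)[OF closed(2)[OF assms]] by simp_all
  have "S (Z u) = S (I (I u))" using relations(1)[OF assms] by simp
  also have "\<dots> = J (J (S u))" using assms by (simp only: relations(5) closed)
  finally show "S (Z u) = Z (S u)" using assms by (simp only: relations(2) closed)
qed

lemma invariant_funI:
  assumes "\<And>u. u \<in> V \<Longrightarrow> h (I u) = h u" "\<And>u. u \<in> V \<Longrightarrow> h (J u) = h u" "\<And>u. u \<in> V \<Longrightarrow> h (S u) = h u"
  shows "invariant_fun h"
  unfolding invariant_fun_def
proof (intro ballI)
  fix g u assume g: "g \<in> carrier G" and u: "u \<in> V"
  let ?inv = "\<lambda>a. a \<in> carrier G \<and> (\<forall>u\<in>V. h (act a u) = h u)"
  have mult: "?inv (a \<otimes> b)" if "?inv a" "?inv b" for a b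
    using that by (auto simp: act_mult act_closed)
  have base: "?inv \<one>" "?inv i" "?inv j" "?inv s"
    using assms gens by (auto simp: act_one)
  have z: "?inv z" using mult[OF base(2) base(2)] by (simp add: ii)
  obtain a b c where a: "a \<in> {\<one>, i, j, i \<otimes> j}" and b: "b \<in> {\<one>, z}"
    and c: "c \<in> {\<one>, s, s \<otimes> s}" and "g = a \<otimes> (b \<otimes> c)"
    using generated[OF g] by blast
  moreover have "?inv a" using a base mult[OF base(2,3)] by (elim insertE emptyE) simp_all
  moreover have "?inv b" using b base z by (elim insertE emptyE) simp_all
  moreover have "?inv c" using c base mult[OF base(4,4)] by (elim insertE emptyE) simp_all
  ultimately have "?inv g" using mult[of a "b \<otimes> c"] mult[of b c] by simp
  then show "h (act g u) = h u" using u by blast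
qed

definition inseparable :: "'k vec \<Rightarrow> 'k vec \<Rightarrow> bool" where
  "inseparable v w \<longleftrightarrow> (\<forall>h\<in>poly_funs 12. invariant_fun h \<longrightarrow> h v = h w)"

lemma inseparableD: "inseparable v w \<Longrightarrow> h \<in> poly_funs d \<Longrightarrow> d \<le> 12 \<Longrightarrow> invariant_fun h \<Longrightarrow> h v = h w"
  unfolding inseparable_def using poly_funs_mono by blast

lemma inseparable_act: "inseparable v w \<Longrightarrow> g \<in> carrier G \<Longrightarrow> v \<in> V \<Longrightarrow> inseparable (act g v) w"
  unfolding inseparable_def invariant_fun_def by metis

section \<open>Functions invariant under the quaternion group\<close>

definition Q8_funs :: "('k vec \<Rightarrow> 'k) set" where
  "Q8_funs = {f \<in> poly_funs 4. \<forall>u\<in>V. f (I u) = f u \<and> f (J u) = f u}"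

lemma poly_funs_coeff_mult:
  assumes "\<And>m. (\<lambda>u. coeff (P u) m) \<in> poly_funs d" "\<And>m. (\<lambda>u. coeff (R u) m) \<in> poly_funs e"
  shows "(\<lambda>u. coeff (P u * R u) m) \<in> poly_funs (d + e)"
  unfolding coeff_mult by (intro poly_funs_sum poly_funs_mult assms)

text \<open>If the claim fails, each of v, S v, S (S v) is told apart from w by its own function.
  Shifted to vanish at w, the three become the coefficients of \<open>P u\<close>, a polynomial in a
  new indeterminate. The coefficients of the product \<open>H\<close> over the translates are
  invariants of degree at most 12, so H v = H w = 0, whereas none of the three factors at v is zero
  and polynomials over a field have no zero divisors.\<close>

lemma Q8_funs_separate:
  assumes E: "inseparable v w" and v: "v \<in> V" and w: "w \<in> V"
  shows "\<exists>c\<in>carrier G. \<forall>f\<in>Q8_funs. f (act c v) = f w"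
proof (rule ccontr)
  assume neg: "\<not> ?thesis"
  have "\<exists>f\<in>Q8_funs. f v \<noteq> f w" using neg act_one[OF v] by (metis one_closed)
  moreover have "\<exists>f\<in>Q8_funs. f (S v) \<noteq> f w" using neg gens by blast
  moreover have "\<exists>f\<in>Q8_funs. f (S (S v)) \<noteq> f w" using neg gens act_mult[OF gens(4,4) v] by (metis m_closed)
  ultimately obtain f0 f1 f2 where f: "f0 \<in> Q8_funs" "f1 \<in> Q8_funs" "f2 \<in> Q8_funs"
    and ne: "f0 v \<noteq> f0 w" "f1 (S v) \<noteq> f1 w" "f2 (S (S v)) \<noteq> f2 w" by blast
  define P where "P u = [:f0 u - f0 w, f1 u - f1 w, f2 u - f2 w:]" for u
  define H where "H u = P u * (P (S u) * P (S (S u)))" for u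
  have P_I: "P (I u) = P u" and P_J: "P (J u) = P u" if "u \<in> V" for u
    using f that by (auto simp: P_def Q8_funs_def)
  have P_poly: "(\<lambda>u. coeff (P u) m) \<in> poly_funs 4" for m
  proof -
    have "(\<lambda>u. f u - f w) \<in> poly_funs 4" if "f \<in> Q8_funs" for f
      using that by (intro poly_funs_diff poly_funs_const) (simp add: Q8_funs_def)
    then show ?thesis
      using f unfolding P_def by (cases m; cases "m - 1"; cases "m - 2")
        (simp_all add: coeff_pCons poly_funs_const split: nat.splits)
  qed
  have PS_poly: "(\<lambda>u. coeff (P (S u)) m) \<in> poly_funs 4" for m
    by (rule poly_funs_act[OF P_poly gens(4)])
  have PSS_poly: "(\<lambda>u. coeff (P (S (S u))) m) \<in> poly_funs 4" for m
    by (rule poly_funs_act[OF PS_poly gens(4)])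
  have "coeff (H v) m = coeff (H w) m" for m
  proof (rule inseparableD[OF E])
    show "(\<lambda>u. coeff (H u) m) \<in> poly_funs (4 + (4 + 4))"
      unfolding H_def by (intro poly_funs_coeff_mult P_poly PS_poly PSS_poly)
    show "invariant_fun (\<lambda>u. coeff (H u) m)"
    proof (rule invariant_funI)
      fix u assume u: "u \<in> V"
      show "coeff (H (I u)) m = coeff (H u) m" "coeff (H (J u)) m = coeff (H u) m"
        using u by (simp_all add: H_def relations central closed P_I P_J)
      show "coeff (H (S u)) m = coeff (H u) m"
        using u by (simp add: H_def relations mult_ac)
    qed
  qed simp
  then have "H v = H w" by (simp add: poly_eq_iff)
  moreover have "P w = 0" by (simp add: P_def)
  ultimately have "P v = 0 \<or> P (S v) = 0 \<or> P (S (S v)) = 0" by (simp add: H_def)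
  then show False using ne by (auto simp: P_def)
qed

section \<open>Functions invariant under the center and their components for the sign
  characters\<close>

definition even_funs :: "('k vec \<Rightarrow> 'k) set" where
  "even_funs = {q \<in> poly_funs 2. \<forall>u\<in>V. q (Z u) = q u}"

lemma even_funs_act: "q \<in> even_funs \<Longrightarrow> (\<lambda>u. q (S u)) \<in> even_funs"
  using gens by (auto simp: even_funs_def poly_funs_act closed central)

lemma even_funs_comb: "q \<in> even_funs \<Longrightarrow> q' \<in> even_funs \<Longrightarrow> (\<lambda>u. q u + t * q' u) \<in> even_funs"
  by (auto simp: even_funs_def poly_funs_add poly_funs_scale)

text \<open>Up to the factor 4, the component of \<open>q\<close> on which \<open>i\<close> and \<open>j\<close> act by \<open>\<alpha>\<close> and \<open>\<beta>\<close>.\<close>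
definition twist :: "'k \<Rightarrow> 'k \<Rightarrow> ('k vec \<Rightarrow> 'k) \<Rightarrow> 'k vec \<Rightarrow> 'k" where
  "twist \<alpha> \<beta> q u = q u + \<alpha> * q (I u) + \<beta> * q (J u) + \<alpha> * \<beta> * q (I (J u))"

lemma twist_poly: "q \<in> even_funs \<Longrightarrow> twist \<alpha> \<beta> q \<in> poly_funs 2"
proof -
  assume "q \<in> even_funs"
  then have q: "q \<in> poly_funs 2" by (simp add: even_funs_def)
  have "(\<lambda>u. q u + \<alpha> * q (I u) + \<beta> * q (J u) + \<alpha> * \<beta> * q (I (J u))) \<in> poly_funs 2"
    by (intro poly_funs_add poly_funs_scale q poly_funs_act[OF q gens(2)] poly_funs_act[OF q gens(3)]
        poly_funs_act[OF poly_funs_act[OF q gens(2)] gens(3)])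
  then show ?thesis by (simp add: twist_def[abs_def])
qed

lemma twist_comb: "twist \<alpha> \<beta> (\<lambda>u. q u + t * q' u) u = twist \<alpha> \<beta> q u + t * twist \<alpha> \<beta> q' u"
  by (simp add: twist_def algebra_simps)

lemma twist_cong: "(\<And>u. u \<in> V \<Longrightarrow> q u = q' u) \<Longrightarrow> u \<in> V \<Longrightarrow> twist \<alpha> \<beta> q u = twist \<alpha> \<beta> q' u"
  by (simp add: twist_def closed)

text \<open>On even functions Q8 acts through its quotient by the center, so \<open>i\<close> and
  \<open>j\<close> permute the four summands. Rewriting with S I = J S and S J = I J S turns the
  weights \<alpha>, \<beta> into \<beta>, \<alpha> * \<beta>, which cycles the three nontrivial
  characters.\<close>

lemma twist_act:
  assumes "q \<in> even_funs" "u \<in> V" "\<alpha> * \<alpha> = 1" "\<beta> * \<beta> = 1"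
  shows "twist \<alpha> \<beta> q (I u) = \<alpha> * twist \<alpha> \<beta> q u" "twist \<alpha> \<beta> q (J u) = \<beta> * twist \<alpha> \<beta> q u"
    "twist \<alpha> \<beta> q (S u) = twist \<beta> (\<alpha> * \<beta>) (\<lambda>u. q (S u)) u"
proof -
  have ev: "q (Z u) = q u" if "u \<in> V" for u using assms(1) that by (simp add: even_funs_def)
  have sq: "\<alpha> * (\<alpha> * x) = x" "\<beta> * (\<beta> * x) = x" for x
    using assms(3,4) by (simp_all flip: mult.assoc)
  show "twist \<alpha> \<beta> q (I u) = \<alpha> * twist \<alpha> \<beta> q u"
    using assms(2) by (simp add: twist_def relations central closed ev sq distrib_left mult_ac)
  show "twist \<alpha> \<beta> q (J u) = \<beta> * twist \<alpha> \<beta> q u"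
    using assms(2) by (simp add: twist_def relations central closed ev sq distrib_left mult_ac)
  show "twist \<alpha> \<beta> q (S u) = twist \<beta> (\<alpha> * \<beta>) (\<lambda>u. q (S u)) u"
    using assms(2) by (simp add: twist_def relations central closed ev sq distrib_left mult_ac)
qed

lemma twist_sum:
  "4 * q u = twist 1 1 q u + twist 1 (- 1) q u + twist (- 1) 1 q u + twist (- 1) (- 1) q u"
  by (simp add: twist_def)

lemma four: "(4::'k) \<noteq> 0"
proof -
  have "(4::'k) = 2 * 2" by simp
  then show ?thesis using two by (metis mult_eq_0_iff)
qed

text \<open>The part of a vector fixed by \<open>Z\<close> is visible in degree 1. The part negated
  by \<open>Z\<close> is visible only through products of two coordinates, hence up to one common
  sign, and \<open>Z\<close> is that sign change.\<close>

lemma even_funs_separate: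
  assumes eq: "\<And>q. q \<in> even_funs \<Longrightarrow> q v = q w" and v: "v \<in> V" and w: "w \<in> V"
  shows "w = v \<or> w = Z v"
proof -
  let ?p = "\<lambda>m u. u $ m + Z u $ m" and ?d = "\<lambda>m u. u $ m - Z u $ m"
  have coord: "(\<lambda>u. u $ m) \<in> poly_funs 1" "(\<lambda>u. Z u $ m) \<in> poly_funs 1" if "m < n" for m
    using poly_funs_coord[OF that] poly_funs_act[OF poly_funs_coord[OF that] gens(1)] by auto
  have "?p m \<in> even_funs" if "m < n" for m
    unfolding even_funs_def
    by (auto intro!: poly_funs_mono[OF poly_funs_add[OF coord[OF that]]] simp: relations)
  then have p: "?p m v = ?p m w" if "m < n" for m using eq that by blast
  have "(\<lambda>u. ?d m u * ?d m' u) \<in> even_funs" if "m < n" "m' < n" for m m'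
    unfolding even_funs_def
    using poly_funs_mult[OF poly_funs_diff[OF coord[OF that(1)]] poly_funs_diff[OF coord[OF that(2)]]]
    by (simp add: relations numeral_2_eq_2 algebra_simps)
  then have "?d m v * ?d m' v = ?d m w * ?d m' w" if "m < n" "m' < n" for m m' using eq that by blast
  then obtain \<epsilon> where \<epsilon>: "\<epsilon> * \<epsilon> = 1" "\<And>m. m < n \<Longrightarrow> ?d m w = \<epsilon> * ?d m v"
    using equal_products_imp_sign[of "{..<n}" "\<lambda>m. ?d m v" "\<lambda>m. ?d m w"] by auto
  have dbl: "2 * w $ m = ?p m v + \<epsilon> * ?d m v" if "m < n" for m
    using p[OF that] \<epsilon>(2)[OF that] by (simp add: algebra_simps)
  consider "\<epsilon> = 1" | "\<epsilon> = - 1" using \<epsilon>(1) sign_cases by blast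
  then show ?thesis
  proof cases
    case 1
    then have "2 * w $ m = 2 * v $ m" if "m < n" for m using dbl[OF that] by simp
    then have "w $ m = v $ m" if "m < n" for m using that two by (metis mult_left_cancel)
    then show ?thesis using v w by (intro disjI1 eq_vecI) auto
  next
    case 2
    then have "2 * w $ m = 2 * Z v $ m" if "m < n" for m using dbl[OF that] by simp
    then have "w $ m = Z v $ m" if "m < n" for m using that two by (metis mult_left_cancel)
    then have "w = Z v"
      by (intro eq_vecI) (simp_all only: carrier_vecD[OF closed(4)[OF v]] carrier_vecD[OF w])
    then show ?thesis ..
  qed
qed

text \<open>A product of two components for the same sign character is invariant under Q8 and has
  degree 4, so it takes the same value at both points.\<close>

lemma twist_sign:
  assumes eq: "\<And>f. f \<in> Q8_funs \<Longrightarrow> f v = f w" and "\<alpha> * \<alpha> = 1" "\<beta> * \<beta> = 1"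
  shows "\<exists>\<epsilon>. \<epsilon> * \<epsilon> = 1 \<and> (\<forall>q\<in>even_funs. twist \<alpha> \<beta> q w = \<epsilon> * twist \<alpha> \<beta> q v)"
proof (rule equal_products_imp_sign)
  fix q q' assume q: "q \<in> even_funs" "q' \<in> even_funs"
  have sq: "\<alpha> * x * (\<alpha> * y) = x * y" "\<beta> * x * (\<beta> * y) = x * y" for x y
    using assms(2,3) by (simp_all add: mult.assoc mult.left_commute[of x] flip: mult.assoc[of \<alpha> \<alpha>] mult.assoc[of \<beta> \<beta>])
  have "(\<lambda>u. twist \<alpha> \<beta> q u * twist \<alpha> \<beta> q' u) \<in> Q8_funs"
    unfolding Q8_funs_def
    using poly_funs_mult[OF twist_poly[OF q(1)] twist_poly[OF q(2)]]
    by (simp add: twist_act[OF q(1) _ assms(2,3)] twist_act[OF q(2) _ assms(2,3)] sq)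
  from eq[OF this] show "twist \<alpha> \<beta> q v * twist \<alpha> \<beta> q' v = twist \<alpha> \<beta> q w * twist \<alpha> \<beta> q' w" .
qed

text \<open>
  The product of \<open>twist 1 (- 1) q\<close> over the powers of \<open>s\<close> is an invariant of degree 6. A field with
  at least four elements has no vector space covered by three hyperplanes, so \<open>q\<close> can be chosen
  such that no factor vanishes at \<open>v\<close>.
\<close>
lemma twist_sign_product:
  assumes E: "inseparable v w" and v: "v \<in> V" and w: "w \<in> V"
    and x: "\<And>q. q \<in> even_funs \<Longrightarrow> twist 1 (- 1) q w = \<epsilon>x * twist 1 (- 1) q v"
    and y: "\<And>q. q \<in> even_funs \<Longrightarrow> twist (- 1) 1 q w = \<epsilon>y * twist (- 1) 1 q v"
    and z: "\<And>q. q \<in> even_funs \<Longrightarrow> twist (- 1) (- 1) q w = \<epsilon>z * twist (- 1) (- 1) q v"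
    and qx: "qx \<in> even_funs" "twist 1 (- 1) qx v \<noteq> 0"
    and qy: "qy \<in> even_funs" "twist (- 1) 1 qy v \<noteq> 0"
    and qz: "qz \<in> even_funs" "twist (- 1) (- 1) qz v \<noteq> 0"
  shows "\<epsilon>x * \<epsilon>y * \<epsilon>z = 1"
proof -
  let ?T = "twist 1 (- 1)"
  have T1: "?T q (S u) = twist (- 1) (- 1) (\<lambda>u. q (S u)) u"
    and T2: "?T q (S (S u)) = twist (- 1) 1 (\<lambda>u. q (S (S u))) u"
    if "q \<in> even_funs" "u \<in> V" for q u
    using twist_act(3)[OF that(1), of _ 1 "-1"] twist_act(3)[OF even_funs_act[OF that(1)], of _ "-1" "-1"] that
    by (simp_all add: closed)
  \<comment> \<open>Shifted by powers of \<open>s\<close> so that \<open>?T\<close> reads the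
    component of \<open>qz\<close> when applied at \<open>S v\<close>, and that of \<open>qy\<close>
    when applied at \<open>S (S v)\<close>; three steps of \<open>s\<close> lead back to
    \<open>v\<close>.\<close>
  define q2 q3 where "q2 = (\<lambda>u. qz (S (S u)))" and "q3 = (\<lambda>u. qy (S u))"
  have q2: "q2 \<in> even_funs" "?T q2 (S v) \<noteq> 0"
    using even_funs_act[OF even_funs_act[OF qz(1)]] T1[of q2 v] v qz(2)
      twist_cong[of "\<lambda>u. qz (S (S (S u)))" qz v "-1" "-1"]
    by (simp_all add: q2_def relations)
  have q3: "q3 \<in> even_funs" "?T q3 (S (S v)) \<noteq> 0"
    using even_funs_act[OF qy(1)] T2[of q3 v] v qy(2)
      twist_cong[of "\<lambda>u. qy (S (S (S u)))" qy v "-1" 1]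
    by (simp_all add: q3_def relations)
  \<comment> \<open>Only \<open>v\<close> and \<open>S v\<close> are treated here, with the pair 1,
    0 filling the third slot; the next combination brings in \<open>q3\<close> for
    \<open>S (S v)\<close>.\<close>
  obtain t where t: "?T qx v + t * ?T q2 v \<noteq> 0" "?T qx (S v) + t * ?T q2 (S v) \<noteq> 0"
    using common_nonzero_combination[OF two three, of "?T qx v" "?T q2 v" "?T qx (S v)" "?T q2 (S v)" 1 0] qx q2 by auto
  define q12 where "q12 = (\<lambda>u. qx u + t * q2 u)"
  have q12: "q12 \<in> even_funs" "?T q12 v \<noteq> 0" "?T q12 (S v) \<noteq> 0"
    using t even_funs_comb[OF qx(1) q2(1)] by (simp_all add: q12_def twist_comb)
  obtain t' where t': "?T q12 v + t' * ?T q3 v \<noteq> 0" "?T q12 (S v) + t' * ?T q3 (S v) \<noteq> 0"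
      "?T q12 (S (S v)) + t' * ?T q3 (S (S v)) \<noteq> 0"
    using common_nonzero_combination[OF two three, of "?T q12 v" "?T q3 v" "?T q12 (S v)" "?T q3 (S v)"
        "?T q12 (S (S v))" "?T q3 (S (S v))"] q12 q3 by auto
  define q where "q = (\<lambda>u. q12 u + t' * q3 u)"
  have q: "q \<in> even_funs" "?T q v \<noteq> 0" "?T q (S v) \<noteq> 0" "?T q (S (S v)) \<noteq> 0"
    using t' even_funs_comb[OF q12(1) q3(1)] by (simp_all add: q_def twist_comb)
  define N where "N u = ?T q u * (?T q (S u) * ?T q (S (S u)))" for u
  have "N v = N w"
  proof (rule inseparableD[OF E])
    show "N \<in> poly_funs (2 + (2 + 2))"
      unfolding N_def[abs_def] using twist_poly[OF q(1)] gens
      by (intro poly_funs_mult poly_funs_act[of "\<lambda>u. ?T q (S u)"] poly_funs_act[of "?T q"])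
    show "invariant_fun N"
    proof (rule invariant_funI)
      fix u assume u: "u \<in> V"
      show "N (I u) = N u" "N (J u) = N u"
        using u by (simp_all add: N_def relations central closed twist_act(1,2)[OF q(1)])
      show "N (S u) = N u"
        using u by (simp add: N_def relations mult_ac)
    qed
  qed simp
  \<comment> \<open>By \<open>T1\<close> and \<open>T2\<close> the three factors are components for
    the three different characters, so each contributes its own sign.\<close>
  also have "N w = \<epsilon>x * \<epsilon>y * \<epsilon>z * N v"
    using x[OF q(1)] z[OF even_funs_act[OF q(1)]] y[OF even_funs_act[OF even_funs_act[OF q(1)]]] v w q(1)
    by (simp add: N_def T1 T2)
  finally show ?thesis using q by (simp add: N_def)
qed

text \<open>If one component vanishes at \<open>v'\<close> for all \<open>q\<close>, it vanishes at
  \<open>w\<close> too, and its sign may be replaced by the product of the other two. Otherwise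
  \<open>twist_sign_product\<close> applies.\<close>

lemma twist_signs:
  assumes E: "inseparable v' w" and v': "v' \<in> V" and w: "w \<in> V"
    and eq: "\<And>f. f \<in> Q8_funs \<Longrightarrow> f v' = f w"
  shows "\<exists>\<epsilon>x \<epsilon>y \<epsilon>z. \<epsilon>x * \<epsilon>x = 1 \<and> \<epsilon>y * \<epsilon>y = 1 \<and> \<epsilon>z * \<epsilon>z = 1 \<and> \<epsilon>x * \<epsilon>y * \<epsilon>z = 1 \<and>
      (\<forall>q\<in>even_funs. twist 1 (- 1) q w = \<epsilon>x * twist 1 (- 1) q v' \<and>
        twist (- 1) 1 q w = \<epsilon>y * twist (- 1) 1 q v' \<and> twist (- 1) (- 1) q w = \<epsilon>z * twist (- 1) (- 1) q v')"
proof -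
  have sign: "\<exists>\<epsilon>. \<epsilon> * \<epsilon> = 1 \<and> (\<forall>q\<in>even_funs. twist \<alpha> \<beta> q w = \<epsilon> * twist \<alpha> \<beta> q v')"
    if "\<alpha> \<in> {1, - 1}" "\<beta> \<in> {1, - 1}" for \<alpha> \<beta>
    by (rule twist_sign[OF eq]) (use that in auto)
  obtain \<epsilon>x where x: "\<epsilon>x * \<epsilon>x = 1" "\<forall>q\<in>even_funs. twist 1 (- 1) q w = \<epsilon>x * twist 1 (- 1) q v'"
    using sign[of 1 "- 1"] by blast
  obtain \<epsilon>y where y: "\<epsilon>y * \<epsilon>y = 1" "\<forall>q\<in>even_funs. twist (- 1) 1 q w = \<epsilon>y * twist (- 1) 1 q v'"
    using sign[of "- 1" 1] by blast
  obtain \<epsilon>z where z: "\<epsilon>z * \<epsilon>z = 1" "\<forall>q\<in>even_funs. twist (- 1) (- 1) q w = \<epsilon>z * twist (- 1) (- 1) q v'"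
    using sign[of "- 1" "- 1"] by blast
  have prod: "a * b * (a * b) = 1" "a * b * a * b = 1" "a * (a * b) * b = 1"
    if "a * a = 1" "b * b = 1" for a b :: 'k
    using that unfolding sign_cases by auto
  consider "\<forall>q\<in>even_funs. twist 1 (- 1) q v' = 0" | "\<forall>q\<in>even_funs. twist (- 1) 1 q v' = 0"
    | "\<forall>q\<in>even_funs. twist (- 1) (- 1) q v' = 0" | "\<epsilon>x * \<epsilon>y * \<epsilon>z = 1"
    using twist_sign_product[OF E v' w x(2)[rule_format] y(2)[rule_format] z(2)[rule_format]] by metis
  then show ?thesis
  proof cases
    case 1
    then have "\<forall>q\<in>even_funs. twist 1 (- 1) q w = (\<epsilon>y * \<epsilon>z) * twist 1 (- 1) q v'" using x(2) by simp
    moreover have "\<epsilon>y * \<epsilon>z * \<epsilon>y * \<epsilon>z = 1" using prod(2) y(1) z(1) by blast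
    ultimately show ?thesis using y z prod(1)[OF y(1) z(1)] by blast
  next
    case 2
    then have "\<forall>q\<in>even_funs. twist (- 1) 1 q w = (\<epsilon>x * \<epsilon>z) * twist (- 1) 1 q v'" using y(2) by simp
    moreover have "\<epsilon>x * (\<epsilon>x * \<epsilon>z) * \<epsilon>z = 1" using prod(3) x(1) z(1) by blast
    ultimately show ?thesis using x z prod(1)[OF x(1) z(1)] by blast
  next
    case 3
    then have "\<forall>q\<in>even_funs. twist (- 1) (- 1) q w = (\<epsilon>x * \<epsilon>y) * twist (- 1) (- 1) q v'" using z(2) by simp
    then show ?thesis using x y prod(1)[OF x(1) y(1)] by blast
  next
    case 4
    then show ?thesis using x y z by blast
  qed
qed

text \<open>The four sign triples with product 1 are the values of the three nontrivial sign
  characters at the elements 1, i, j and i j.\<close>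

lemma twist_signs_realized:
  assumes v': "v' \<in> V"
    and \<epsilon>: "\<epsilon>x * \<epsilon>x = 1" "\<epsilon>y * \<epsilon>y = 1" "\<epsilon>z * \<epsilon>z = 1" "\<epsilon>x * \<epsilon>y * \<epsilon>z = 1"
  shows "\<exists>g\<in>carrier G. \<forall>q\<in>even_funs. twist 1 1 q (act g v') = twist 1 1 q v' \<and>
      twist 1 (- 1) q (act g v') = \<epsilon>x * twist 1 (- 1) q v' \<and>
      twist (- 1) 1 q (act g v') = \<epsilon>y * twist (- 1) 1 q v' \<and>
      twist (- 1) (- 1) q (act g v') = \<epsilon>z * twist (- 1) (- 1) q v'"
proof -
    have "(1::'k) \<noteq> - 1"
    proof
      assume "(1::'k) = - 1"
      then have "(1::'k) + 1 = 0" by (simp only: eq_neg_iff_add_eq_0)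
      with two show False by simp
    qed
    then consider "\<epsilon>x = 1" "\<epsilon>y = 1" "\<epsilon>z = 1" | "\<epsilon>x = 1" "\<epsilon>y = - 1" "\<epsilon>z = - 1"
      | "\<epsilon>x = - 1" "\<epsilon>y = 1" "\<epsilon>z = - 1" | "\<epsilon>x = - 1" "\<epsilon>y = - 1" "\<epsilon>z = 1"
      using \<epsilon> unfolding sign_cases by auto
    then show ?thesis
    proof cases
      case 1 then show ?thesis using v' by (intro bexI[of _ \<one>]) (simp_all add: act_one)
    next
      case 2 then show ?thesis using v' gens by (intro bexI[of _ i]) (simp_all add: twist_act)
    next
      case 3 then show ?thesis using v' gens by (intro bexI[of _ j]) (simp_all add: twist_act)
    next
      case 4 then show ?thesis using v' gens
        by (intro bexI[of _ "i \<otimes> j"]) (simp_all add: twist_act act_mult closed)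
    qed
qed

text \<open>Three corrections are composed: \<open>c\<close> makes the Q8-invariant functions agree,
  \<open>g\<close> adjusts the three signs so that all even functions agree, and what then remains
  is at most a factor \<open>z\<close>.\<close>

lemma inseparable_imp_same_orbit:
  assumes E: "inseparable v w" and v: "v \<in> V" and w: "w \<in> V"
  shows "\<exists>g\<in>carrier G. w = act g v"
proof -
  obtain c where c: "c \<in> carrier G" and eqw: "\<And>f. f \<in> Q8_funs \<Longrightarrow> f (act c v) = f w"
    using Q8_funs_separate[OF assms] by blast
  define v' where "v' = act c v"
  have v': "v' \<in> V" and E': "inseparable v' w" and eq: "\<And>f. f \<in> Q8_funs \<Longrightarrow> f v' = f w"
    using act_closed[OF c v] inseparable_act[OF E c v] eqw by (simp_all add: v'_def)
  have eq1: "twist 1 1 q w = twist 1 1 q v'" if q: "q \<in> even_funs" for q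
    by (rule eq[symmetric])
      (use twist_act[OF q, of _ 1 1] poly_funs_mono[OF twist_poly[OF q]] in \<open>simp add: Q8_funs_def\<close>)
  note signs = twist_signs[OF E' v' w eq]
  from signs obtain \<epsilon>x \<epsilon>y \<epsilon>z where \<epsilon>: "\<epsilon>x * \<epsilon>x = 1" "\<epsilon>y * \<epsilon>y = 1" "\<epsilon>z * \<epsilon>z = 1" "\<epsilon>x * \<epsilon>y * \<epsilon>z = 1"
    and tw: "\<And>q. q \<in> even_funs \<Longrightarrow> twist 1 (- 1) q w = \<epsilon>x * twist 1 (- 1) q v'"
      "\<And>q. q \<in> even_funs \<Longrightarrow> twist (- 1) 1 q w = \<epsilon>y * twist (- 1) 1 q v'"
      "\<And>q. q \<in> even_funs \<Longrightarrow> twist (- 1) (- 1) q w = \<epsilon>z * twist (- 1) (- 1) q v'"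
    by blast
  obtain g where g: "g \<in> carrier G" and tg: "\<And>q. q \<in> even_funs \<Longrightarrow> twist 1 1 q (act g v') = twist 1 1 q v' \<and>
      twist 1 (- 1) q (act g v') = \<epsilon>x * twist 1 (- 1) q v' \<and>
      twist (- 1) 1 q (act g v') = \<epsilon>y * twist (- 1) 1 q v' \<and>
      twist (- 1) (- 1) q (act g v') = \<epsilon>z * twist (- 1) (- 1) q v'"
    using twist_signs_realized[OF v' \<epsilon>] by blast
  have "q (act g v') = q w" if q: "q \<in> even_funs" for q
  proof -
    have "4 * q (act g v') = 4 * q w"
      unfolding twist_sum[of q] using tg[OF q] tw[OF q] eq1[OF q] by simp
    then show ?thesis by (rule mult_left_cancel[OF four, THEN iffD1])
  qed
  then have "w = act g v' \<or> w = Z (act g v')"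
    using even_funs_separate act_closed[OF g v'] w by blast
  moreover have "act g v' = act (g \<otimes> c) v" "Z (act g v') = act (z \<otimes> (g \<otimes> c)) v"
    using g c gens v by (simp_all add: v'_def act_mult act_closed)
  ultimately show ?thesis using g c gens by (metis m_closed)
qed

lemma separating_degree_12: "separating_set G n \<rho> {f \<in> invariants G n \<rho>. total_degree f \<le> 12}"
  unfolding separating_set_def
proof (intro conjI ballI impI)
  show "{f \<in> invariants G n \<rho>. total_degree f \<le> 12} \<subseteq> invariants G n \<rho>" by blast
next
  fix v w assume v: "v \<in> V" and w: "w \<in> V" and ne: "vec_orbit G \<rho> v \<noteq> vec_orbit G \<rho> w"
  show "\<exists>f\<in>{f \<in> invariants G n \<rho>. total_degree f \<le> 12}. mpoly_eval f v \<noteq> mpoly_eval f w"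
  proof (rule ccontr)
    assume "\<not> ?thesis"
    then have "mpoly_eval f v = mpoly_eval f w" if "f \<in> invariants G n \<rho>" "total_degree f \<le> 12" for f
      using that by blast
    then have "inseparable v w"
      unfolding inseparable_def using invariant_fun_eq[OF order_nz _ _ _ v w] by blast
    then obtain g where "g \<in> carrier G" "w = act g v"
      using inseparable_imp_same_orbit v w by blast
    then show False using ne vec_orbit_act v by simp
  qed
qed

lemma beta_sep_le_12: "beta_sep G n \<rho> \<le> 12"
proof -
  have "beta_sep G n \<rho> \<le> enat 12"
    unfolding beta_sep_def using separating_degree_12 by (intro Inf_lower) auto
  then show ?thesis by (simp add: numeral_eq_enat)
qed

end

section \<open>The relations and the normal form, checked on Hurwitz units\<close>

lemma quat_embed_mult:
  "x \<in> set hurwitz_units \<Longrightarrow> y \<in> set hurwitz_units \<Longrightarrow>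
    quat_embed x \<otimes>\<^bsub>binary_tetrahedral\<^esub> quat_embed y = quat_embed (quat_mult x y)"
  by (simp only: binary_tetrahedral_simps complex.quat_mat_mult)

text \<open>The element s is -(1 + i + j + k) / 2. Its real part -1/2 makes the order 3, whereas the
  opposite sign would give order 6.\<close>

lemma hurwitz_relations:
  "list_all (\<lambda>x. x \<in> set hurwitz_units)
     [(2, 0, 0, 0), (-2, 0, 0, 0), (0, 2, 0, 0), (0, 0, 2, 0), (0, 0, 0, 2), (-1, -1, -1, -1), (-1, 1, 1, 1)] \<and>
   quat_mult (-2, 0, 0, 0) (-2, 0, 0, 0) = (2, 0, 0, 0) \<and>
   quat_mult (0, 2, 0, 0) (0, 2, 0, 0) = (-2, 0, 0, 0) \<and>
   quat_mult (0, 0, 2, 0) (0, 0, 2, 0) = (-2, 0, 0, 0) \<and>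
   quat_mult (0, 2, 0, 0) (0, 0, 2, 0) = (0, 0, 0, 2) \<and>
   quat_mult (0, 0, 2, 0) (0, 2, 0, 0) = quat_mult (-2, 0, 0, 0) (0, 0, 0, 2) \<and>
   quat_mult (-1, -1, -1, -1) (0, 2, 0, 0) = quat_mult (0, 0, 2, 0) (-1, -1, -1, -1) \<and>
   quat_mult (-1, -1, -1, -1) (0, 0, 2, 0) = quat_mult (0, 0, 0, 2) (-1, -1, -1, -1) \<and>
   quat_mult (-1, -1, -1, -1) (-1, -1, -1, -1) = (-1, 1, 1, 1) \<and>
   quat_mult (-1, -1, -1, -1) (-1, 1, 1, 1) = (2, 0, 0, 0)"
  by code_simp

lemma hurwitz_generated:
  "list_all (\<lambda>x. \<exists>a\<in>set [(2, 0, 0, 0), (0, 2, 0, 0), (0, 0, 2, 0), (0, 0, 0, 2)].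
     \<exists>b\<in>set [(2, 0, 0, 0), (-2, 0, 0, 0)]. \<exists>c\<in>set [(2, 0, 0, 0), (-1, -1, -1, -1), (-1, 1, 1, 1)].
     x = quat_mult a (quat_mult b c)) hurwitz_units"
  by code_simp

lemma tetrahedral_rep_binary_tetrahedral:
  fixes \<rho> :: "complex mat \<Rightarrow> 'k::field mat"
  assumes "\<rho> \<in> hom binary_tetrahedral (GL n)" and char: "\<not> CHAR('k) dvd 24"
  shows "tetrahedral_rep binary_tetrahedral n \<rho> (quat_embed (-2, 0, 0, 0)) (quat_embed (0, 2, 0, 0))
    (quat_embed (0, 0, 2, 0)) (quat_embed (-1, -1, -1, -1))"
proof -
  interpret group binary_tetrahedral by (rule group_binary_tetrahedral)
  have in_units: "(2, 0, 0, 0) \<in> set hurwitz_units" "(-2, 0, 0, 0) \<in> set hurwitz_units"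
    "(0, 2, 0, 0) \<in> set hurwitz_units" "(0, 0, 2, 0) \<in> set hurwitz_units" "(0, 0, 0, 2) \<in> set hurwitz_units"
    "(-1, -1, -1, -1) \<in> set hurwitz_units" "(-1, 1, 1, 1) \<in> set hurwitz_units"
    using hurwitz_relations by simp_all
  have one: "\<one>\<^bsub>binary_tetrahedral\<^esub> = quat_embed (2, 0, 0, 0)"
    unfolding binary_tetrahedral_simps by (rule complex.quat_mat_one[symmetric])
  have k: "quat_embed (0, 2, 0, 0) \<otimes>\<^bsub>binary_tetrahedral\<^esub> quat_embed (0, 0, 2, 0) = quat_embed (0, 0, 0, 2)"
    and ss: "quat_embed (-1, -1, -1, -1) \<otimes>\<^bsub>binary_tetrahedral\<^esub> quat_embed (-1, -1, -1, -1) = quat_embed (-1, 1, 1, 1)"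
    using hurwitz_relations by (simp_all only: quat_embed_mult in_units)
  have nz: "of_nat d \<noteq> (0::'k)" if "d dvd 24" for d
    using char that by (metis dvd_trans of_nat_eq_0_iff_char_dvd)
  show ?thesis
  proof
    show "\<rho> \<in> hom binary_tetrahedral (GL n)" by fact
    show "finite (carrier binary_tetrahedral)"
      by (rule card_ge_0_finite) (simp add: card_binary_tetrahedral)
    show "of_nat (Coset.order binary_tetrahedral) \<noteq> (0::'k)"
      using nz[of 24] by (simp only: Coset.order_def card_binary_tetrahedral dvd_refl not_False_eq_True)
    show "(2::'k) \<noteq> 0" "(3::'k) \<noteq> 0" using nz[of 2] nz[of 3] by simp_all
  next
    fix g assume "g \<in> carrier binary_tetrahedral"
    then obtain x where x: "x \<in> set hurwitz_units" "g = quat_embed x"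
      unfolding binary_tetrahedral_carrier by blast
    then obtain a b c where a: "a \<in> set [(2, 0, 0, 0), (0, 2, 0, 0), (0, 0, 2, 0), (0, 0, 0, 2)]"
      and b: "b \<in> set [(2, 0, 0, 0), (-2, 0, 0, 0)]"
      and c: "c \<in> set [(2, 0, 0, 0), (-1, -1, -1, -1), (-1, 1, 1, 1)]"
      and abc: "x = quat_mult a (quat_mult b c)"
      using hurwitz_generated unfolding list_all_iff by blast
    have units: "a \<in> set hurwitz_units" "b \<in> set hurwitz_units" "c \<in> set hurwitz_units"
      using a b c in_units by auto
    have "g = quat_embed a \<otimes>\<^bsub>binary_tetrahedral\<^esub> (quat_embed b \<otimes>\<^bsub>binary_tetrahedral\<^esub> quat_embed c)"
      unfolding x(2) abc by (simp only: quat_embed_mult units quat_mult_closed)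
    moreover have "quat_embed a \<in> {\<one>\<^bsub>binary_tetrahedral\<^esub>, quat_embed (0, 2, 0, 0), quat_embed (0, 0, 2, 0),
        quat_embed (0, 2, 0, 0) \<otimes>\<^bsub>binary_tetrahedral\<^esub> quat_embed (0, 0, 2, 0)}"
      using a unfolding one k by (auto simp del: quat_mat.simps)
    moreover have "quat_embed b \<in> {\<one>\<^bsub>binary_tetrahedral\<^esub>, quat_embed (-2, 0, 0, 0)}"
      using b unfolding one by (auto simp del: quat_mat.simps)
    moreover have "quat_embed c \<in> {\<one>\<^bsub>binary_tetrahedral\<^esub>, quat_embed (-1, -1, -1, -1),
        quat_embed (-1, -1, -1, -1) \<otimes>\<^bsub>binary_tetrahedral\<^esub> quat_embed (-1, -1, -1, -1)}"
      using c unfolding one ss by (auto simp del: quat_mat.simps)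
    ultimately show "\<exists>a\<in>{\<one>\<^bsub>binary_tetrahedral\<^esub>, quat_embed (0, 2, 0, 0), quat_embed (0, 0, 2, 0),
          quat_embed (0, 2, 0, 0) \<otimes>\<^bsub>binary_tetrahedral\<^esub> quat_embed (0, 0, 2, 0)}.
        \<exists>b\<in>{\<one>\<^bsub>binary_tetrahedral\<^esub>, quat_embed (-2, 0, 0, 0)}.
        \<exists>c\<in>{\<one>\<^bsub>binary_tetrahedral\<^esub>, quat_embed (-1, -1, -1, -1),
          quat_embed (-1, -1, -1, -1) \<otimes>\<^bsub>binary_tetrahedral\<^esub> quat_embed (-1, -1, -1, -1)}.
        g = a \<otimes>\<^bsub>binary_tetrahedral\<^esub> (b \<otimes>\<^bsub>binary_tetrahedral\<^esub> c)" by blast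
  qed (use hurwitz_relations in \<open>simp_all only: binary_tetrahedral_carrier imageI quat_embed_mult in_units one\<close>)
qed

section \<open>The lower bound\<close>

text \<open>The restriction of \<open>f\<close> to the line through \<open>u\<close>, kept as a
  formal polynomial in the parameter because a finite field has too few points. Its coefficient at
  \<open>k\<close> is the value at \<open>u\<close> of the homogeneous part of degree
  \<open>k\<close>.\<close>

definition on_line :: "'k::field mpoly \<Rightarrow> (nat \<Rightarrow> 'k) \<Rightarrow> 'k poly" where
  "on_line f u = mpoly_subst (\<lambda>a. [:a:]) (\<lambda>i. monom (u i) 1) f"

lemma comm_ring_hom_pCons: "comm_ring_hom (\<lambda>a::'k::field. [:a:])"
  by unfold_locales (auto simp: one_pCons)

lemma monom_value_monom: "monom_value (\<lambda>i. monom (u i) 1) m = monom (monom_value u m) (monom_degree m)"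
proof -
  have "(\<Prod>i\<in>A. monom (u i) 1 ^ k i) = monom (\<Prod>i\<in>A. u i ^ k i) (\<Sum>i\<in>A. k i)" for A and k :: "nat \<Rightarrow> nat"
    by (induction A rule: infinite_finite_induct) (auto simp: monom_power mult_monom)
  then show ?thesis by (simp add: monom_value_def monom_degree_def)
qed

lemma coeff_on_line:
  "coeff (on_line f u) k =
    (\<Sum>m\<in>Poly_Mapping.keys f. if monom_degree m = k then Poly_Mapping.lookup f m * monom_value u m else 0)"
  unfolding on_line_def mpoly_subst_def monom_value_def[symmetric] monom_value_monom
  by (simp add: coeff_sum smult_monom)

lemma on_line_scale: "coeff (on_line f (\<lambda>i. c * u i)) k = c ^ k * coeff (on_line f u) k"
proof -
  have "monom_value (\<lambda>i. c * u i) m = c ^ monom_degree m * monom_value u m" for m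
    by (simp add: monom_value_def monom_degree_def power_mult_distrib prod.distrib power_sum)
  then show ?thesis
    unfolding coeff_on_line sum_distrib_left by (intro sum.cong) auto
qed

lemma on_line_cong: "f \<in> mpoly_ring n \<Longrightarrow> (\<And>i. i < n \<Longrightarrow> u i = u' i) \<Longrightarrow> on_line f u = on_line f u'"
  unfolding on_line_def by (rule mpoly_subst_cong) auto

lemma mpoly_eval_on_line:
  assumes "total_degree f \<le> d"
  shows "mpoly_eval f v = (\<Sum>k\<le>d. coeff (on_line f (\<lambda>i. v $ i)) k)"
proof -
  have at1: "comm_ring_hom (\<lambda>p::'a poly. poly p 1)" by unfold_locales auto
  have "degree (on_line f (\<lambda>i. v $ i)) \<le> d"
  proof (rule degree_le, intro allI impI)
    fix k assume "d < k"
    with assms have "monom_degree m \<noteq> k" if "m \<in> Poly_Mapping.keys f" for m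
      using that by (fastforce simp: total_degree_le_iff)
    then show "coeff (on_line f (\<lambda>i. v $ i)) k = 0"
      unfolding coeff_on_line by (intro sum.neutral) auto
  qed
  moreover have "mpoly_eval f v = poly (on_line f (\<lambda>i. v $ i)) 1"
    unfolding on_line_def comm_ring_hom.hom_mpoly_subst[OF at1] by (simp add: mpoly_eval_def poly_monom)
  moreover have "poly p 1 = (\<Sum>k\<le>d. coeff p k)" if "degree p \<le> d" for p :: "'a poly"
    unfolding poly_altdef using that by (intro sum.mono_neutral_cong_left) (auto simp: coeff_eq_0)
  ultimately show ?thesis by simp
qed

text \<open>The action of the inverse of \<open>g\<close> fixes \<open>f\<close> and moves the line
  through \<open>u\<close> to the line through its image under \<open>g\<close>. As an equality of
  polynomials this compares all homogeneous parts at once.\<close>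

lemma (in matrix_rep) on_line_invariant:
  assumes f: "f \<in> invariants G n \<rho>" and g: "g \<in> carrier G"
  shows "on_line f (\<lambda>i. \<Sum>j<n. \<rho> g $$ (i, j) * u j) = on_line f u"
proof -
  have "on_line f u = on_line (mpoly_act G n \<rho> (inv g) f) u"
    using f g by (simp add: invariants_def)
  also have "\<dots> = on_line f (\<lambda>i. \<Sum>j<n. \<rho> g $$ (i, j) * u j)"
    unfolding on_line_def subst_mpoly_act[OF comm_ring_hom_pCons inv_closed[OF g]]
    by (rule arg_cong[of _ _ "\<lambda>s. mpoly_subst _ s f"])
      (use g in \<open>simp add: fun_eq_iff smult_monom monom_sum\<close>)
  finally show ?thesis ..
qed

text \<open>The sum of e^l over the fourth roots of unity 1, -1, x, -x is 4 if 4 divides l and 0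
  otherwise. In degree 4 this leaves the two pure powers, whose coefficients are the values at (1,
  0) and (0, 1).\<close>

lemma quartic_sum_roots_of_unity:
  fixes f :: "'k::field mpoly" and x :: 'k
  assumes f: "f \<in> mpoly_ring 2" and x: "x * x = - 1"
  defines "q \<equiv> \<lambda>a b. coeff (on_line f (\<lambda>i. if i = 0 then a else b)) 4"
  shows "q 1 1 + q 1 (- 1) + q 1 x + q 1 (- x) = 4 * (q 1 0 + q 0 1)"
proof -
  let ?u = "\<lambda>a b (i::nat). if i = 0 then a else b :: 'k"
  have vals: "monom_value (?u 1 1) m + monom_value (?u 1 (- 1)) m + monom_value (?u 1 x) m +
      monom_value (?u 1 (- x)) m = 4 * (monom_value (?u 1 0) m + monom_value (?u 0 1) m)"
    if m: "m \<in> Poly_Mapping.keys f" and deg: "monom_degree m = 4" for m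
  proof -
    have sub: "Poly_Mapping.keys m \<subseteq> {0, 1}"
      using f m by (fastforce simp: mpoly_ring_def less_Suc_eq numeral_2_eq_2)
    define k l where "k = Poly_Mapping.lookup m 0" and "l = Poly_Mapping.lookup m 1"
    have "monom_degree m = (\<Sum>i\<in>{0, 1}. Poly_Mapping.lookup m i)"
      unfolding monom_degree_def using sub by (intro sum.mono_neutral_left) (auto simp: in_keys_iff)
    then have kl: "k + l = 4" using deg by (simp add: k_def l_def)
    have v: "monom_value (?u a b) m = a ^ k * b ^ l" for a b
      by (subst monom_value_superset[OF _ sub]) (simp_all add: k_def l_def)
    have pow: "x ^ 2 = - 1" "x ^ 3 = - x" "x ^ 4 = 1" by (simp_all add: eval_nat_numeral x)
    have "l = 0 \<or> l = 1 \<or> l = 2 \<or> l = 3 \<or> l = 4" using kl by arith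
    moreover have "k = 4 - l" using kl by arith
    ultimately show ?thesis
      unfolding v by (elim disjE) (simp_all add: pow)
  qed
  have "L * monom_value (?u 1 1) m + L * monom_value (?u 1 (- 1)) m + L * monom_value (?u 1 x) m +
      L * monom_value (?u 1 (- x)) m = 4 * (L * monom_value (?u 1 0) m + L * monom_value (?u 0 1) m)"
    if "m \<in> Poly_Mapping.keys f" "monom_degree m = 4" for m L
  proof -
    have "L * monom_value (?u 1 1) m + L * monom_value (?u 1 (- 1)) m + L * monom_value (?u 1 x) m +
        L * monom_value (?u 1 (- x)) m = L * (4 * (monom_value (?u 1 0) m + monom_value (?u 0 1) m))"
      unfolding vals[OF that, symmetric] by (simp only: distrib_left)
    then show ?thesis by (simp only: distrib_left mult.left_commute)
  qed
  then show ?thesis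
    unfolding q_def coeff_on_line sum.distrib[symmetric] sum_distrib_left
    by (intro sum.cong refl) simp
qed

text \<open>With these parameters j acts diagonally, with entries \<open>\<zeta>\<^sup>2\<close> and
  its negative. It therefore preserves the line through (1, 0) and multiplies its parameter by a
  square root of -1.\<close>

lemma lower_bound_rep:
  fixes \<zeta> h :: "'k::field"
  assumes zeta: "\<zeta> ^ 4 = - 1" and h: "2 * h = 1" and char: "\<not> CHAR('k) dvd 24"
  shows "12 \<le> beta_sep binary_tetrahedral 2 (quat_mat h (\<zeta>\<^sup>2) 0 \<circ> quat_of)"
proof -
  let ?x = "\<zeta>\<^sup>2" let ?\<rho> = "quat_mat h ?x 0 \<circ> quat_of"
  have xx: "?x * ?x = - 1" using zeta by (simp flip: power_add)
  interpret quat_matrices h ?x 0 by unfold_locales (use h xx in auto)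
  have hom: "?\<rho> \<in> hom binary_tetrahedral (GL 2)" by (rule quat_mat_hom)
  interpret tetrahedral_rep binary_tetrahedral 2 ?\<rho> "quat_embed (-2, 0, 0, 0)" "quat_embed (0, 2, 0, 0)"
      "quat_embed (0, 0, 2, 0)" "quat_embed (-1, -1, -1, -1)"
    by (rule tetrahedral_rep_binary_tetrahedral[OF hom char])
  have nz: "of_nat d \<noteq> (0::'k)" if "d dvd 24" for d
    using char that by (metis dvd_trans of_nat_eq_0_iff_char_dvd)
  define u where "u a b = (\<lambda>i::nat. if i = 0 then a else b :: 'k)" for a b
  have inv: "on_line f (u (h * ((of_int a + of_int c * ?x) * p + (of_int d * ?x - of_int b) * r))
        (h * ((of_int b + of_int d * ?x) * p + (of_int a - of_int c * ?x) * r))) = on_line f (u p r)"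
    if f: "f \<in> invariants binary_tetrahedral 2 ?\<rho>" and q: "(a, b, c, d) \<in> set hurwitz_units" for f a b c d p r
  proof -
    have g: "quat_embed (a, b, c, d) \<in> carrier binary_tetrahedral"
      unfolding binary_tetrahedral_carrier using q by (rule imageI)
    have rho: "?\<rho> (quat_embed (a, b, c, d)) = quat_mat h ?x 0 (a, b, c, d)"
      by (simp only: comp_apply quat_of_embed)
    have "on_line f (u p r) = on_line f (\<lambda>i. \<Sum>j<2. ?\<rho> (quat_embed (a, b, c, d)) $$ (i, j) * u p r j)"
      by (rule on_line_invariant[OF f g, symmetric])
    also have "\<dots> = on_line f (u (h * ((of_int a + of_int c * ?x) * p + (of_int d * ?x - of_int b) * r))
        (h * ((of_int b + of_int d * ?x) * p + (of_int a - of_int c * ?x) * r)))"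
      unfolding rho
    proof (rule on_line_cong[of _ 2])
      show "f \<in> mpoly_ring 2" using f by (simp add: invariants_def)
    qed (auto simp: u_def less_Suc_eq numeral_2_eq_2 algebra_simps)
    finally show ?thesis ..
  qed
  have scale: "coeff (on_line f (u (c * a) (c * b))) k = c ^ k * coeff (on_line f (u a b)) k" for f c a b k
    using on_line_scale[of f c "u a b" k] by (simp add: u_def if_distrib cong: if_cong)
  have x1: "?x \<noteq> 1" "- ?x \<noteq> 1" "(- 1 :: 'k) \<noteq> 1"
  proof -
    show 1: "(- 1 :: 'k) \<noteq> 1" unfolding neg_eq_iff_add_eq_0 using two by simp
    show "?x \<noteq> 1" "- ?x \<noteq> 1" using xx 1 by (metis minus_mult_minus mult_1)+
  qed
  have coeffs: "(\<Sum>k\<le>11. c ^ k * coeff (on_line f (u 1 0)) k) =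
      coeff (on_line f (u 1 0)) 0 + c ^ 8 * coeff (on_line f (u 1 0)) 8"
    if f: "f \<in> invariants binary_tetrahedral 2 ?\<rho>" for f c
  proof -
    let ?q = "\<lambda>a b. coeff (on_line f (u a b))"
    \<comment> \<open>With x = \<open>?x\<close>, j sends (1, 0) to (x, 0), and i sends it to (0,
      1). The units with entries 1 and -1 send it to h (1 + x) (1, e) for e = 1, -1, x, -x in this
      order.\<close>
    have u: "(2, 0, 0, 0) \<in> set hurwitz_units" "(0, 0, 2, 0) \<in> set hurwitz_units"
        "(0, 2, 0, 0) \<in> set hurwitz_units" "(1, 1, 1, 1) \<in> set hurwitz_units"
        "(1, -1, 1, -1) \<in> set hurwitz_units" "(1, -1, 1, 1) \<in> set hurwitz_units"
        "(1, 1, 1, -1) \<in> set hurwitz_units"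
      by (simp_all add: hurwitz_units_def)
    have h2: "h * 2 = 1" "h * (2 * y) = y" "h * (y * 2) = y" for y
      using h by (simp_all add: mult.commute mult.left_commute flip: mult.assoc)
    have "?q ?x 0 = ?q 1 0" using inv[OF f u(2), of 1 0] by (simp add: h2)
    then have fix_x: "?x ^ k * ?q 1 0 k = ?q 1 0 k" for k using scale[of f ?x 1 0 k] by simp
    have zero: "?q 1 0 k = 0" if "?x ^ k \<noteq> 1" for k using fix_x[of k] that by simp
    have "?q 0 1 = ?q 1 0" using inv[OF f u(3), of 1 0] by (simp add: h2)
    \<comment> \<open>The degree 4 factor of the scalar in front of (1, e). As x^2 = -1, its square
      root is h x, so it equals -1/4.\<close>
    define t where "t = (h * (1 + ?x)) ^ 4"
    have t: "4 * t = - 1"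
    proof -
      have "(h * (1 + ?x)) ^ 2 = h * (h * (1 + 2 * ?x + ?x * ?x))"
        by (simp add: power2_eq_square algebra_simps)
      also have "\<dots> = h * ?x" unfolding xx by (simp add: h2)
      finally have "t = (h * ?x) ^ 2" unfolding t_def by (metis numeral_Bit0 power_add power2_eq_square)
      then have "4 * t = (2 * h) * (2 * h) * (?x * ?x)" by (simp add: power2_eq_square)
      then show ?thesis unfolding h xx by simp
    qed
    have "t * ?q 1 1 4 = ?q 1 0 4"
      using inv[OF f u(4), of 1 0] scale[of f "h * (1 + ?x)" 1 1 4] by (simp add: t_def)
    moreover have "t * ?q 1 (- 1) 4 = ?q 1 0 4"
      using inv[OF f u(5), of 1 0] scale[of f "h * (1 + ?x)" 1 "- 1" 4] by (simp add: t_def algebra_simps)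
    moreover have "t * ?q 1 ?x 4 = ?q 1 0 4"
      using inv[OF f u(6), of 1 0] scale[of f "h * (1 + ?x)" 1 ?x 4] xx by (simp add: t_def algebra_simps)
    moreover have "t * ?q 1 (- ?x) 4 = ?q 1 0 4"
      using inv[OF f u(7), of 1 0] scale[of f "h * (1 + ?x)" 1 "- ?x" 4] xx by (simp add: t_def algebra_simps)
    ultimately have "t * (?q 1 1 4 + ?q 1 (- 1) 4 + ?q 1 ?x 4 + ?q 1 (- ?x) 4) = 4 * ?q 1 0 4"
      by (simp add: distrib_left)
    moreover have "f \<in> mpoly_ring 2" using f by (simp add: invariants_def)
    ultimately have "t * (4 * (?q 1 0 4 + ?q 0 1 4)) = 4 * ?q 1 0 4"
      using quartic_sum_roots_of_unity[OF _ xx, of f] unfolding u_def by simp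
    \<comment> \<open>The values at (1, 0) and (0, 1) coincide. Inserting t = -1/4 yields -2 q = 4 q
      for this common value q, and 6 is invertible.\<close>
    then have "(4 * t) * (2 * ?q 1 0 4) = 4 * ?q 1 0 4"
      unfolding \<open>?q 0 1 = ?q 1 0\<close> by (simp add: algebra_simps)
    then have "- (2 * ?q 1 0 4) = 4 * ?q 1 0 4" unfolding t by simp
    then have "6 * ?q 1 0 4 = 0" by (simp add: neg_eq_iff_add_eq_0 flip: distrib_right)
    then have q4: "?q 1 0 4 = 0" using nz[of 6] by simp
    have "?x ^ 4 = 1" using xx by (simp add: eval_nat_numeral)
    then have period: "?x ^ (4 * m + r) = ?x ^ r" for m r by (simp add: power_add power_mult)
    have x_pow: "?x ^ 2 = - 1" "?x ^ 3 = - ?x" using xx by (simp_all add: eval_nat_numeral)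
    \<comment> \<open>x has order 4, so by \<open>zero\<close> only degrees divisible by 4 can
      survive; degree 4 has just been excluded.\<close>
    have "?q 1 0 1 = 0" "?q 1 0 2 = 0" "?q 1 0 3 = 0" "?q 1 0 5 = 0" "?q 1 0 6 = 0" "?q 1 0 7 = 0"
        "?q 1 0 9 = 0" "?q 1 0 10 = 0" "?q 1 0 11 = 0"
      using x1 x_pow period[of 1 1] period[of 1 2] period[of 1 3] period[of 2 1] period[of 2 2] period[of 2 3]
      by (auto intro!: zero simp del: power_mult)
    with q4 show ?thesis
      by (simp add: eval_nat_numeral atMost_Suc)
  qed
  have "\<not> separating_set binary_tetrahedral 2 ?\<rho> {f \<in> invariants binary_tetrahedral 2 ?\<rho>. total_degree f \<le> d}"
    if d: "d \<le> 11" for d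
  proof
    assume sep: "separating_set binary_tetrahedral 2 ?\<rho> {f \<in> invariants binary_tetrahedral 2 ?\<rho>. total_degree f \<le> d}"
    \<comment> \<open>Both points lie on the line through (1, 0), and their parameters 1 and \<zeta>
      have the same eighth power.\<close>
    define v w where "v = vec 2 (u 1 0)" and "w = vec 2 (u \<zeta> 0)"
    have "mpoly_eval f v = mpoly_eval f w"
      if f: "f \<in> invariants binary_tetrahedral 2 ?\<rho>" "total_degree f \<le> d" for f
    proof -
      have ring: "f \<in> mpoly_ring 2" using f by (simp add: invariants_def)
      have eval: "mpoly_eval f (vec 2 (u c 0)) = (\<Sum>k\<le>11. c ^ k * coeff (on_line f (u 1 0)) k)" for c
      proof -
        have "mpoly_eval f (vec 2 (u c 0)) = (\<Sum>k\<le>11. coeff (on_line f (\<lambda>i. vec 2 (u c 0) $ i)) k)"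
          using f d by (intro mpoly_eval_on_line) simp
        also have "on_line f (\<lambda>i. vec 2 (u c 0) $ i) = on_line f (u (c * 1) (c * 0))"
          by (rule on_line_cong[OF ring]) (simp add: u_def)
        finally show ?thesis unfolding scale .
      qed
      have "\<zeta> ^ 8 = 1"
        using power_add[of \<zeta> 4 4] by (simp add: zeta)
      then show ?thesis
        unfolding v_def w_def eval coeffs[OF f(1)] by simp
    qed
    then have "vec_orbit binary_tetrahedral ?\<rho> w = vec_orbit binary_tetrahedral ?\<rho> v"
      using sep unfolding separating_set_def v_def w_def
      by (metis (mono_tags, lifting) mem_Collect_eq vec_carrier)
    moreover have "w \<in> vec_orbit binary_tetrahedral ?\<rho> w"
      unfolding vec_orbit_def using act_one[of w] by (intro image_eqI[of _ _ "\<one>\<^bsub>binary_tetrahedral\<^esub>"]) (simp_all add: w_def)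
    ultimately obtain g where "g \<in> carrier binary_tetrahedral" "w = ?\<rho> g *\<^sub>v v"
      unfolding vec_orbit_def by auto
    then obtain q where q: "q \<in> set hurwitz_units" and wq: "w = quat_mat h ?x 0 q *\<^sub>v v"
      unfolding binary_tetrahedral_carrier by (auto simp del: quat_mat.simps)
    obtain a b c d where abcd: "q = (a, b, c, d)" by (cases q)
    have w0: "\<zeta> = h * (of_int a + of_int c * ?x)" and w1: "0 = h * (of_int b + of_int d * ?x)"
      using arg_cong[OF wq, of "\<lambda>v. v $ 0"] arg_cong[OF wq, of "\<lambda>v. v $ 1"]
      unfolding abcd by (simp_all add: w_def v_def u_def scalar_prod_def numeral_2_eq_2)
    have h0: "h \<noteq> 0" and hh: "4 * (h * h) = 1"
    proof -
      show "h \<noteq> 0" using h by auto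
      have "4 * (h * h) = (2 * h) * (2 * h)" by simp
      then show "4 * (h * h) = 1" unfolding h by simp
    qed
    \<comment> \<open>A unit sending (1, 0) to (\<zeta>, 0) has b + d x = 0, hence b^2 + d^2 = 0 in
      K. As 2 and 4 are nonzero, only 1, j and their negatives remain, and they would give \<zeta>^2
      = 1 or \<zeta>^2 = -1.\<close>
    have "list_all (\<lambda>(a, b, c, d). b * b + d * d = 2 \<or> b * b + d * d = 4 \<or>
        a * a = 4 \<and> c = 0 \<or> a = 0 \<and> c * c = 4) hurwitz_units"
      by code_simp
    then consider "b * b + d * d = 2" | "b * b + d * d = 4" | "a * a = 4" "c = 0" | "a = 0" "c * c = 4"
      using q unfolding abcd list_all_iff by fastforce
    moreover have "of_int b * of_int b + of_int d * of_int d = (0::'k)"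
    proof -
      have "of_int b = - (of_int d * ?x)" using w1 h0 by (simp add: eq_neg_iff_add_eq_0)
      then have "of_int b * of_int b = of_int d * of_int d * (?x * ?x)" by simp
      then show ?thesis unfolding xx by simp
    qed
    then have bd: "of_int (b * b + d * d) = (0::'k)" by simp
    ultimately show False
    proof cases
      case 1 then show False using bd nz[of 2] by simp
    next
      case 2 then show False using bd nz[of 4] by simp
    next
      case 3
      have "?x = h * h * of_int (a * a)" using w0 3(2) by (simp add: power2_eq_square)
      then have "?x = 1" unfolding 3(1) using hh by (simp add: mult.commute)
      then show False using x1 by simp
    next
      case 4
      have "?x = h * h * of_int (c * c) * (?x * ?x)"
        by (subst (1) w0) (simp add: power2_eq_square 4(1))
      then have "?x = - 1" unfolding 4(2) xx using hh by (simp add: mult.commute)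
      then show False using x1 by simp
    qed
  qed
  note not_separating = this
  have "12 \<le> d" if "separating_set binary_tetrahedral 2 ?\<rho>
      {f \<in> invariants binary_tetrahedral 2 ?\<rho>. total_degree f \<le> d}" for d
  proof (rule ccontr)
    assume "\<not> 12 \<le> d"
    then have "d \<le> 11" by simp
    then show False using not_separating that by blast
  qed
  then show ?thesis
    unfolding beta_sep_def by (auto intro!: Inf_greatest simp: numeral_eq_enat)
qed

theorem theorem3p5:
  assumes "\<not> CHAR('k::field) dvd 24"
    and "\<exists>\<zeta>::'k. \<zeta> ^ 8 = 1 \<and> (\<forall>m. 0 < m \<and> m < 8 \<longrightarrow> \<zeta> ^ m \<noteq> 1)"
  shows "binary_tetrahedral \<cong> (SL 2 :: 3 mat monoid) \<and>
    Coset.order binary_tetrahedral = 24 \<and>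
    beta_sep_group TYPE('k) binary_tetrahedral = 12"
proof (intro conjI)
  show "binary_tetrahedral \<cong> (SL 2 :: 3 mat monoid)" by (rule binary_tetrahedral_iso)
  show "Coset.order binary_tetrahedral = 24"
    by (simp add: Coset.order_def card_binary_tetrahedral)
  obtain \<zeta> :: 'k where \<zeta>: "\<zeta> ^ 8 = 1" "\<zeta> ^ 4 \<noteq> 1" using assms(2) by fastforce
  then have zeta: "\<zeta> ^ 4 = - 1"
    using sign_cases[of "\<zeta> ^ 4"] by (simp flip: power_add)
  have "of_nat 2 \<noteq> (0::'k)"
    unfolding of_nat_eq_0_iff_char_dvd using assms(1) dvd_trans[of "CHAR('k)" 2 24] by auto
  then have half: "2 * (1 / 2) = (1::'k)" by simp
  show "beta_sep_group TYPE('k) binary_tetrahedral = 12"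
  proof (rule antisym)
    show "beta_sep_group TYPE('k) binary_tetrahedral \<le> 12"
      unfolding beta_sep_group_def
    proof (rule Sup_least, clarify)
      fix n and \<rho> :: "complex mat \<Rightarrow> 'k mat"
      assume "\<rho> \<in> hom binary_tetrahedral (GL n)"
      then show "beta_sep binary_tetrahedral n \<rho> \<le> 12"
        using tetrahedral_rep_binary_tetrahedral assms(1) by (blast intro: tetrahedral_rep.beta_sep_le_12)
    qed
  next
    interpret quat_matrices "1 / 2 :: 'k" "\<zeta>\<^sup>2" 0
      by unfold_locales (use half zeta in \<open>simp_all flip: power_add\<close>)
    show "12 \<le> beta_sep_group TYPE('k) binary_tetrahedral"
      unfolding beta_sep_group_def
      using lower_bound_rep[OF zeta half assms(1)] quat_mat_hom
      by (intro order_trans[OF _ Sup_upper]) auto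
  qed
qed

end
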